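(* Let $X$ be a GO space that is either scattered or locally countable. Then the following are equivalent: (i) $X$ is functionally countable; (ii) $X$ is exponentially separable; (iii) $X$ has countable extent.
   Context: A LOTS is a linearly ordered set equipped with its order topology; a GO (generalized ordered) space is a topological space that can be embedded as a subspace of a LOTS. A space is scattered if every nonempty subspace has an isolated point (relative to that subspace). A space is locally countable if every point has a countable neighborhood. A space has countable extent if each of its closed discrete subsets is countable. A space $X$ is functionally countable if $f[X]$ is countable for every continuous $f\colon X\to\mathbb{R}$. Given a family $\mathcal{F}$ of subsets of $X$, a set $A\subset X$ is strongly dense in $\mathcal{F}$ if $A\cap\bigcap\mathcal{G}\neq\emptyset$ whenever $\mathcal{G}\subset\mathcal{F}$ and $\bigcap\mathcal{G}\neq\emptyset$. $X$ is exponentially separable if for every countable family $\mathcal{F}$ of closed subsets of $X$ there is a countable $A\subset X$ that is strongly dense in $\mathcal{F}$. *)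

theory Defs
  imports "HOL-Analysis.Analysis"
begin

(* The set A itself belongs to the subbase so that the topology has underlying set A
   also when A has at most one element (there the open rays do not cover A). *)
definition order_topology_on :: "'b set \<Rightarrow> 'b rel \<Rightarrow> 'b topology" where
  "order_topology_on A r =
     topology_generated_by
       (insert A
         ((\<lambda>a. {x \<in> A. (x, a) \<in> r \<and> x \<noteq> a}) ` A \<union>
          (\<lambda>a. {x \<in> A. (a, x) \<in> r \<and> x \<noteq> a}) ` A))"

definition LOTS :: "'b topology \<Rightarrow> bool" where
  "LOTS L \<longleftrightarrow>
     (\<exists>r. linear_order_on (topspace L) r \<and> L = order_topology_on (topspace L) r)"

(* HOL cannot quantify existentially over the type carrying the ambient LOTS, so this type is
   a parameter. In a theorem with hypothesis GO_space TYPE('b) X whose conclusion does not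
   involve 'b, the type variable is universally quantified outside, which amounts to the
   hypothesis "X embeds in some LOTS, on whatever type". *)
definition GO_space :: "'b itself \<Rightarrow> 'a topology \<Rightarrow> bool" where
  "GO_space _ X \<longleftrightarrow> (\<exists>(L :: 'b topology) f. LOTS L \<and> embedding_map X L f)"

definition scattered_space :: "'a topology \<Rightarrow> bool" where
  "scattered_space X \<longleftrightarrow>
     (\<forall>S. S \<subseteq> topspace X \<and> S \<noteq> {} \<longrightarrow> (\<exists>x\<in>S. openin (subtopology X S) {x}))"

definition locally_countable_space :: "'a topology \<Rightarrow> bool" where
  "locally_countable_space X \<longleftrightarrow>
     (\<forall>x\<in>topspace X. \<exists>N U. N \<subseteq> topspace X \<and> countable N \<and> openin X U \<and> x \<in> U \<and> U \<subseteq> N)"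

definition countable_extent :: "'a topology \<Rightarrow> bool" where
  "countable_extent X \<longleftrightarrow>
     (\<forall>D. closedin X D \<and> subtopology X D = discrete_topology D \<longrightarrow> countable D)"

definition functionally_countable :: "'a topology \<Rightarrow> bool" where
  "functionally_countable X \<longleftrightarrow>
     (\<forall>f. continuous_map X euclideanreal f \<longrightarrow> countable (f ` topspace X))"

(* Intersections are taken inside the space: the empty subfamily has intersection
   topspace X, whereas \<Inter>{} = UNIV. *)
definition strongly_dense_in :: "'a topology \<Rightarrow> 'a set set \<Rightarrow> 'a set \<Rightarrow> bool" where
  "strongly_dense_in X \<F> A \<longleftrightarrow>
     (\<forall>\<G>. \<G> \<subseteq> \<F> \<and> topspace X \<inter> \<Inter>\<G> \<noteq> {} \<longrightarrow> A \<inter> (topspace X \<inter> \<Inter>\<G>) \<noteq> {})"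

definition exponentially_separable :: "'a topology \<Rightarrow> bool" where
  "exponentially_separable X \<longleftrightarrow>
     (\<forall>\<F>. countable \<F> \<and> (\<forall>C\<in>\<F>. closedin X C) \<longrightarrow>
          (\<exists>A. A \<subseteq> topspace X \<and> countable A \<and> strongly_dense_in X \<F> A))"

end

theory Submission
  imports Defs
begin

text \<open>
  Exponential separability gives functional countability because every fibre of a continuous real
  function is an intersection of preimages of closed intervals with rational endpoints. GO spaces
  are normal, so on an uncountable closed discrete set Tietze's theorem yields a continuous
  function with uncountable range.

  For the remaining implication fix a countable family of closed sets and call a set captured if
  countably many points suffice to meet every intersection of members of the family that contains
  a point of the set. Captured sets form a sigma-ideal. If every point has a captured
  neighbourhood, the points that are joined to a given one by a captured interval form a clopen
  set, and countable extent leaves only countably many such classes. Going up in a class, either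
  the class has countable cofinality, or the members of the family that are unbounded in it share
  a point there while all the others are bounded by a common point. Finally, an isolated point of
  the set of points without captured neighbourhood can be treated one side at a time, in the same
  way; so in a scattered space there is no such point.
\<close>

section \<open>Exponential separability and continuous real functions\<close>

text \<open>Strong density is applied to the largest subfamily whose intersection contains
  \<open>x\<close>, namely all members through \<open>x\<close>.\<close>

lemma strongly_dense_inD:
  assumes "strongly_dense_in X \<F> A" "x \<in> topspace X"
  obtains a where "a \<in> A" "\<And>C. C \<in> \<F> \<Longrightarrow> x \<in> C \<Longrightarrow> a \<in> C"
proof -
  let ?G = "{C \<in> \<F>. x \<in> C}"
  have "?G \<subseteq> \<F> \<and> topspace X \<inter> \<Inter>?G \<noteq> {}" using assms(2) by auto
  then have "A \<inter> (topspace X \<inter> \<Inter>?G) \<noteq> {}"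
    using assms(1)[unfolded strongly_dense_in_def, rule_format, of ?G] by simp
  then obtain a where "a \<in> A" "a \<in> \<Inter>?G" by auto
  then show ?thesis using that by simp
qed

lemma exponentially_separable_imp_functionally_countable:
  assumes "exponentially_separable X"
  shows "functionally_countable X"
  unfolding functionally_countable_def
proof (intro allI impI)
  fix f assume f: "continuous_map X euclideanreal f"
  define P :: "rat \<Rightarrow> rat \<Rightarrow> 'a set"
    where "P a b = {x \<in> topspace X. f x \<in> {of_rat a..of_rat b}}" for a b
  define \<F> where "\<F> = (\<lambda>(a, b). P a b) ` UNIV"
  have "countable \<F>" unfolding \<F>_def by (intro countable_image) auto
  moreover have "\<forall>C\<in>\<F>. closedin X C"
    unfolding \<F>_def P_def
    by (auto simp del: atLeastAtMost_iff intro!: closedin_continuous_map_preimage[OF f])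
  ultimately obtain A where A: "A \<subseteq> topspace X" "countable A" "strongly_dense_in X \<F> A"
    using assms unfolding exponentially_separable_def by blast
  have "f ` topspace X \<subseteq> f ` A"
  proof safe
    fix x assume x: "x \<in> topspace X"
    obtain a where a: "a \<in> A" "\<And>C. C \<in> \<F> \<Longrightarrow> x \<in> C \<Longrightarrow> a \<in> C"
      using strongly_dense_inD[OF A(3) x] by blast
    have *: "of_rat p \<le> f a \<and> f a \<le> of_rat q" if "of_rat p \<le> f x" "f x \<le> of_rat q" for p q
    proof -
      have "P p q \<in> \<F>" unfolding \<F>_def by auto
      moreover have "x \<in> P p q" using that x by (auto simp: P_def)
      ultimately have "a \<in> P p q" using a(2) by blast
      then show ?thesis by (simp add: P_def)
    qed
    \<comment> \<open>The sets \<open>P a b\<close> carry two-sided information only, so a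
      comparison of \<open>f x\<close> with a single rational is completed to an interval by
      \<open>p0\<close> or \<open>q0\<close>.\<close>
    obtain p0 q0 where pq: "of_rat p0 < f x" "f x < of_rat q0"
      using of_rat_dense[of "f x - 1" "f x"] of_rat_dense[of "f x" "f x + 1"] by auto
    have "f a = f x"
    proof (rule ccontr)
      assume "f a \<noteq> f x"
      then consider "f a < f x" | "f x < f a" by linarith
      then show False
      proof cases
        case 1
        then obtain r where "f a < of_rat r" "of_rat r < f x" using of_rat_dense by blast
        then show False using *[of r q0] pq by auto
      next
        case 2
        then obtain r where "f x < of_rat r" "of_rat r < f a" using of_rat_dense by blast
        then show False using *[of p0 r] pq by auto
      qed
    qed
    then show "f x \<in> f ` A" using a(1) by (metis imageI)
  qed
  then show "countable (f ` topspace X)"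
    by (rule countable_subset) (simp add: A(2))
qed

section \<open>Closed discrete sets and countable extent\<close>

text \<open>Compare the cardinal of \<open>D\<close> with that of the reals. Either \<open>D\<close>
  injects into the reals, or the reals inject into \<open>D\<close> and a left inverse maps
  \<open>D\<close> onto them. An injection cannot be asked for, since \<open>D\<close> may be larger
  than the continuum.\<close>

lemma uncountable_imp_uncountable_real_image:
  assumes "uncountable D"
  obtains g :: "'a \<Rightarrow> real" where "uncountable (g ` D)"
proof (cases "(card_of D, card_of (UNIV :: real set)) \<in> ordLeq")
  case True
  then obtain g :: "'a \<Rightarrow> real" where "inj_on g D"
    using iffD2[OF card_of_ordLeq] by metis
  then show ?thesis using assms that countable_image_inj_on by metis
next
  case False
  then have "(card_of (UNIV :: real set), card_of D) \<in> ordLeq"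
    using ordLeq_total[OF card_of_Well_order card_of_Well_order] by blast
  then obtain h :: "real \<Rightarrow> 'a" where h: "inj h" "range h \<subseteq> D"
    using iffD2[OF card_of_ordLeq] by metis
  have "inv h ` D = UNIV"
  proof (rule set_eqI, rule iffI)
    fix y
    have "inv h (h y) = y" "h y \<in> D" using h by auto
    then show "y \<in> inv h ` D" by (metis imageI)
  qed simp
  then show ?thesis using that[of "inv h"] uncountable_UNIV_real by simp
qed

lemma normal_functionally_countable_imp_countable_extent:
  assumes "normal_space X" "functionally_countable X"
  shows "countable_extent X"
  unfolding countable_extent_def
proof (intro allI impI, rule ccontr)
  fix D assume D: "closedin X D \<and> subtopology X D = discrete_topology D" and "uncountable D"
  then obtain g :: "'a \<Rightarrow> real" where g: "uncountable (g ` D)"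
    using uncountable_imp_uncountable_real_image by blast
  have "continuous_map (subtopology X D) euclideanreal g" using D by simp
  then obtain h where h: "continuous_map X euclideanreal h" "\<And>x. x \<in> D \<Longrightarrow> h x = g x"
    using Tietze_extension_realinterval[OF assms(1), of D UNIV g] D by auto
  have "g ` D \<subseteq> h ` topspace X"
    using h(2) D closedin_subset by (metis image_cong image_mono)
  then show False
    using h(1) g assms(2) countable_subset unfolding functionally_countable_def by metis
qed

text \<open>In a T1 space a point with a neighbourhood that meets \<open>E\<close> in a finite set
  is no accumulation point of \<open>E\<close>, so \<open>E\<close> is closed and discrete. Apart
  from its inheritance by closed subspaces, countable extent is applied in this form only.\<close>

lemma countable_extent_locally_finite:
  assumes "countable_extent X" "t1_space X" "E \<subseteq> topspace X"
    and "\<And>x. x \<in> topspace X \<Longrightarrow> \<exists>U. openin X U \<and> x \<in> U \<and> finite (E \<inter> U)"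
  shows "countable E"
proof -
  have "X derived_set_of E = {}"
    using assms(2,4) unfolding t1_space_derived_set_of_infinite_openin by fastforce
  then have "closedin X E \<and> subtopology X E = discrete_topology E"
    using assms(3) by (simp add: closedin_contains_derived_set subtopology_eq_discrete_topology_eq)
  then show ?thesis using assms(1) unfolding countable_extent_def by blast
qed

lemma countable_extent_closed_subspace:
  assumes "countable_extent X" "closedin X K"
  shows "countable_extent (subtopology X K)"
  unfolding countable_extent_def
proof (intro allI impI)
  fix D assume D: "closedin (subtopology X K) D \<and> subtopology (subtopology X K) D = discrete_topology D"
  then have "closedin X D" using assms(2) closedin_trans_full by blast
  moreover have "K \<inter> D = D" using D closedin_subset by fastforce
  ultimately show "countable D"
    using D assms(1) unfolding countable_extent_def by (simp add: subtopology_subtopology)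
qed

section \<open>Captured sets\<close>

text \<open>The witnesses in \<open>A\<close> may lie outside \<open>Y\<close>; this is what makes
  the notion pass to subsets of \<open>Y\<close>.\<close>

definition captured :: "'a topology \<Rightarrow> 'a set set \<Rightarrow> 'a set \<Rightarrow> bool" where
  "captured X \<F> Y \<longleftrightarrow>
     (\<exists>A\<subseteq>topspace X. countable A \<and> (\<forall>x\<in>Y. \<exists>a\<in>A. \<forall>C\<in>\<F>. x \<in> C \<longrightarrow> a \<in> C))"

text \<open>A subfamily whose intersection contains \<open>x\<close> consists of members through
  \<open>x\<close>, so a witness for all members through \<open>x\<close> serves every such
  subfamily. Hence subfamilies can be replaced by points.\<close>

lemma exponentially_separable_iff_captured:
  "exponentially_separable X \<longleftrightarrow>
     (\<forall>\<F>. countable \<F> \<and> (\<forall>C\<in>\<F>. closedin X C) \<longrightarrow> captured X \<F> (topspace X))"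
proof -
  have *: "strongly_dense_in X \<F> A \<longleftrightarrow>
      (\<forall>x\<in>topspace X. \<exists>a\<in>A. \<forall>C\<in>\<F>. x \<in> C \<longrightarrow> a \<in> C)" (is "_ \<longleftrightarrow> ?R")
    if A: "A \<subseteq> topspace X" for \<F> A
  proof
    assume sd: "strongly_dense_in X \<F> A"
    show ?R
    proof
      fix x assume "x \<in> topspace X"
      then show "\<exists>a\<in>A. \<forall>C\<in>\<F>. x \<in> C \<longrightarrow> a \<in> C"
        using strongly_dense_inD[OF sd] by metis
    qed
  next
    assume R: ?R
    show "strongly_dense_in X \<F> A"
      unfolding strongly_dense_in_def
    proof (intro allI impI)
      fix \<G> assume G: "\<G> \<subseteq> \<F> \<and> topspace X \<inter> \<Inter>\<G> \<noteq> {}"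
      then obtain x where x: "x \<in> topspace X" "x \<in> \<Inter>\<G>" by blast
      obtain a where a: "a \<in> A" "\<forall>C\<in>\<F>. x \<in> C \<longrightarrow> a \<in> C"
        using bspec[OF R x(1)] by auto
      have "a \<in> topspace X \<inter> \<Inter>\<G>"
      proof
        show "a \<in> topspace X" using a(1) A by (rule rev_subsetD)
        show "a \<in> \<Inter>\<G>"
        proof
          fix C assume "C \<in> \<G>"
          then have "C \<in> \<F>" "x \<in> C" using G x(2) by auto
          then show "a \<in> C" using a(2) by simp
        qed
      qed
      then show "A \<inter> (topspace X \<inter> \<Inter>\<G>) \<noteq> {}" using a(1) by auto
    qed
  qed
  show ?thesis
    unfolding exponentially_separable_def captured_def by (simp add: * cong: conj_cong)
qed

lemma captured_subset: "captured X \<F> Z \<Longrightarrow> Y \<subseteq> Z \<Longrightarrow> captured X \<F> Y"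
  unfolding captured_def by (meson subsetD)

lemma captured_UN:
  assumes "countable I" "\<And>i. i \<in> I \<Longrightarrow> captured X \<F> (Y i)"
  shows "captured X \<F> (\<Union>i\<in>I. Y i)"
proof -
  have "\<forall>i\<in>I. \<exists>A. A \<subseteq> topspace X \<and> countable A \<and> (\<forall>x\<in>Y i. \<exists>a\<in>A. \<forall>C\<in>\<F>. x \<in> C \<longrightarrow> a \<in> C)"
    using assms(2) unfolding captured_def by blast
  then obtain A where A: "\<forall>i\<in>I. A i \<subseteq> topspace X \<and> countable (A i) \<and>
      (\<forall>x\<in>Y i. \<exists>a\<in>A i. \<forall>C\<in>\<F>. x \<in> C \<longrightarrow> a \<in> C)"
    by metis
  then show ?thesis
    using assms(1) unfolding captured_def
    by (intro exI[of _ "\<Union>i\<in>I. A i"]) (auto, meson)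
qed

lemma captured_Un:
  assumes "captured X \<F> Y" "captured X \<F> Z"
  shows "captured X \<F> (Y \<union> Z)"
proof -
  have "Y \<union> Z = (\<Union>b\<in>UNIV. if b then Y else Z)" by (auto split: if_splits)
  then show ?thesis using captured_UN[of UNIV X \<F> "\<lambda>b. if b then Y else Z"] assms by simp
qed

text \<open>Serves for the end pieces of intervals: there every member of the family that still
  meets \<open>Y\<close> contains one fixed point, which may lie outside \<open>Y\<close>.\<close>

lemma captured_by_point:
  assumes "p \<in> topspace X" "\<And>x C. x \<in> Y \<Longrightarrow> C \<in> \<F> \<Longrightarrow> x \<in> C \<Longrightarrow> p \<in> C"
  shows "captured X \<F> Y"
  unfolding captured_def using assms by (intro exI[of _ "{p}"]) auto

lemma captured_countable:
  assumes "countable Y" "Y \<subseteq> topspace X"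
  shows "captured X \<F> Y"
  unfolding captured_def using assms by (intro exI[of _ Y]) auto

lemma captured_subspace:
  assumes "captured (subtopology X K) ((\<lambda>C. K \<inter> C) ` \<F>) Y" "Y \<subseteq> K"
  shows "captured X \<F> Y"
proof -
  obtain A where A: "A \<subseteq> topspace X \<inter> K" "countable A"
      "\<forall>x\<in>Y. \<exists>a\<in>A. \<forall>C\<in>(\<lambda>C. K \<inter> C) ` \<F>. x \<in> C \<longrightarrow> a \<in> C"
    using assms(1) unfolding captured_def topspace_subtopology by (elim exE conjE)
  have "\<exists>a\<in>A. \<forall>C\<in>\<F>. x \<in> C \<longrightarrow> a \<in> C" if x: "x \<in> Y" for x
  proof -
    have "x \<in> K" using x assms(2) by (rule rev_subsetD)
    moreover obtain a where "a \<in> A" "\<forall>C\<in>(\<lambda>C. K \<inter> C) ` \<F>. x \<in> C \<longrightarrow> a \<in> C"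
      using bspec[OF A(3) x] by (elim bexE)
    ultimately show ?thesis by (intro bexI[of _ a]) auto
  qed
  then show ?thesis
    unfolding captured_def using A(1,2) by (intro exI[of _ A]) simp
qed

text \<open>Adding \<open>K\<close> to the family forces the witness of a point of \<open>K\<close>
  to lie in \<open>K\<close> as well.\<close>

lemma captured_into_subspace:
  assumes "captured X (insert K \<F>) Y" "Y \<subseteq> K"
  shows "captured (subtopology X K) ((\<lambda>C. K \<inter> C) ` \<F>) Y"
proof -
  obtain A where A: "A \<subseteq> topspace X" "countable A"
      "\<forall>x\<in>Y. \<exists>a\<in>A. \<forall>C\<in>insert K \<F>. x \<in> C \<longrightarrow> a \<in> C"
    using assms(1) unfolding captured_def by (elim exE conjE)
  have "\<exists>a\<in>A \<inter> K. \<forall>C\<in>(\<lambda>C. K \<inter> C) ` \<F>. x \<in> C \<longrightarrow> a \<in> C" if x: "x \<in> Y" for x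
  proof -
    have "x \<in> K" using x assms(2) by (rule rev_subsetD)
    moreover obtain a where "a \<in> A" "\<forall>C\<in>insert K \<F>. x \<in> C \<longrightarrow> a \<in> C"
      using bspec[OF A(3) x] by (elim bexE)
    ultimately show ?thesis by (intro bexI[of _ a]) auto
  qed
  moreover have "A \<inter> K \<subseteq> topspace (subtopology X K)" "countable (A \<inter> K)"
    using A(1,2) by auto
  ultimately show ?thesis
    unfolding captured_def by (intro exI[of _ "A \<inter> K"]) simp
qed

text \<open>Restricting to a closed segment \<open>K\<close> enlarges the family by
  \<open>K\<close>. A local hypothesis must survive this, hence the quantification over all
  countable families.\<close>

definition captured_always :: "'a topology \<Rightarrow> 'a set \<Rightarrow> bool" where
  "captured_always X Y \<longleftrightarrow> (\<forall>\<F>. countable \<F> \<longrightarrow> (\<forall>C\<in>\<F>. closedin X C) \<longrightarrow> captured X \<F> Y)"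

lemma captured_alwaysD:
  "captured_always X Y \<Longrightarrow> countable \<F> \<Longrightarrow> (\<And>C. C \<in> \<F> \<Longrightarrow> closedin X C) \<Longrightarrow> captured X \<F> Y"
  unfolding captured_always_def by simp

section \<open>Ordered GO spaces\<close>

text \<open>
  The order lives on the whole type; only its restriction to the points of the space matters.
\<close>

locale ordered_go = linorder less_eq less
  for less_eq :: "'a \<Rightarrow> 'a \<Rightarrow> bool" (infix "\<sqsubseteq>" 50)
    and less :: "'a \<Rightarrow> 'a \<Rightarrow> bool" (infix "\<sqsubset>" 50) +
  fixes X :: "'a topology"
  assumes openin_lower: "a \<in> topspace X \<Longrightarrow> openin X {x \<in> topspace X. x \<sqsubset> a}"
    and openin_upper: "a \<in> topspace X \<Longrightarrow> openin X {x \<in> topspace X. a \<sqsubset> x}"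
    and convex_base: "openin X U \<Longrightarrow> x \<in> U \<Longrightarrow>
      \<exists>V. openin X V \<and> x \<in> V \<and> V \<subseteq> U \<and>
        (\<forall>a\<in>V. \<forall>b\<in>V. \<forall>z\<in>topspace X. a \<sqsubseteq> z \<longrightarrow> z \<sqsubseteq> b \<longrightarrow> z \<in> V)"
begin

text \<open>The axioms are symmetric in the two directions of the order, so every one-sided result
  below also yields its mirror image.\<close>

lemma dual: "ordered_go (\<lambda>x y. y \<sqsubseteq> x) (\<lambda>x y. y \<sqsubset> x) X"
  unfolding ordered_go_def ordered_go_axioms_def
proof (intro conjI allI impI)
  show "class.linorder (\<lambda>x y. y \<sqsubseteq> x) (\<lambda>x y. y \<sqsubset> x)" by (rule dual_linorder)
next
  fix U x assume "openin X U" "x \<in> U"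
  from convex_base[OF this]
  show "\<exists>V. openin X V \<and> x \<in> V \<and> V \<subseteq> U \<and>
        (\<forall>a\<in>V. \<forall>b\<in>V. \<forall>z\<in>topspace X. z \<sqsubseteq> a \<longrightarrow> b \<sqsubseteq> z \<longrightarrow> z \<in> V)" by metis
qed (auto intro: openin_lower openin_upper)

text \<open>The trace of a convex set on \<open>K\<close> is convex relative to the points of
  \<open>K\<close>, so the axioms are hereditary. This allows results on whole spaces to be applied
  inside closed segments.\<close>

lemma subspace: "ordered_go (\<sqsubseteq>) (\<sqsubset>) (subtopology X K)"
  unfolding ordered_go_def ordered_go_axioms_def
proof (intro conjI allI impI)
  show "class.linorder (\<sqsubseteq>) (\<sqsubset>)" by (rule linorder_axioms)
next
  fix a assume "a \<in> topspace (subtopology X K)"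
  then have a: "a \<in> topspace X" by simp
  have "{x \<in> topspace (subtopology X K). x \<sqsubset> a} = K \<inter> {x \<in> topspace X. x \<sqsubset> a}" by auto
  then show "openin (subtopology X K) {x \<in> topspace (subtopology X K). x \<sqsubset> a}"
    using openin_lower[OF a] by (simp add: openin_subtopology_Int2)
  have "{x \<in> topspace (subtopology X K). a \<sqsubset> x} = K \<inter> {x \<in> topspace X. a \<sqsubset> x}" by auto
  then show "openin (subtopology X K) {x \<in> topspace (subtopology X K). a \<sqsubset> x}"
    using openin_upper[OF a] by (simp add: openin_subtopology_Int2)
next
  fix U x assume "openin (subtopology X K) U" and x: "x \<in> U"
  then obtain W where W: "openin X W" "U = W \<inter> K" unfolding openin_subtopology by auto
  then obtain V where V: "openin X V" "x \<in> V" "V \<subseteq> W"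
      "\<forall>a\<in>V. \<forall>b\<in>V. \<forall>z\<in>topspace X. a \<sqsubseteq> z \<longrightarrow> z \<sqsubseteq> b \<longrightarrow> z \<in> V"
    using convex_base[of W x] x by auto
  show "\<exists>V. openin (subtopology X K) V \<and> x \<in> V \<and> V \<subseteq> U \<and>
        (\<forall>a\<in>V. \<forall>b\<in>V. \<forall>z\<in>topspace (subtopology X K). a \<sqsubseteq> z \<longrightarrow> z \<sqsubseteq> b \<longrightarrow> z \<in> V)"
  proof (intro exI[of _ "V \<inter> K"] conjI ballI impI)
    show "openin (subtopology X K) (V \<inter> K)" using V(1) by (rule openin_subtopology_Int)
    show "x \<in> V \<inter> K" using V(2) W(2) x by simp
    show "V \<inter> K \<subseteq> U" using V(3) W(2) by auto
  next
    fix a b z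
    assume "a \<in> V \<inter> K" "b \<in> V \<inter> K" "z \<in> topspace (subtopology X K)" "a \<sqsubseteq> z" "z \<sqsubseteq> b"
    then show "z \<in> V \<inter> K" using V(4)[rule_format, of a b z] by simp
  qed
qed

definition order_convex :: "'a set \<Rightarrow> bool" where
  "order_convex V \<longleftrightarrow> (\<forall>a\<in>V. \<forall>b\<in>V. \<forall>z\<in>topspace X. a \<sqsubseteq> z \<longrightarrow> z \<sqsubseteq> b \<longrightarrow> z \<in> V)"

lemma order_convexD:
  "order_convex V \<Longrightarrow> a \<in> V \<Longrightarrow> b \<in> V \<Longrightarrow> z \<in> topspace X \<Longrightarrow> a \<sqsubseteq> z \<Longrightarrow> z \<sqsubseteq> b \<Longrightarrow> z \<in> V"
  by (rule order_convex_def[THEN iffD1, rule_format])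

lemma order_convex_Int: "order_convex V \<Longrightarrow> order_convex W \<Longrightarrow> order_convex (V \<inter> W)"
  unfolding order_convex_def[of "V \<inter> W"] by (auto dest: order_convexD)

lemma order_convex_lower: "order_convex {x \<in> topspace X. x \<sqsubset> a}"
  unfolding order_convex_def by (auto intro: le_less_trans)

lemma convex_nbhd:
  assumes "openin X U" "x \<in> U"
  obtains V where "openin X V" "x \<in> V" "V \<subseteq> U" "V \<subseteq> topspace X" "order_convex V"
proof -
  obtain V where "openin X V" "x \<in> V" "V \<subseteq> U" "order_convex V"
    using convex_base[OF assms] unfolding order_convex_def[symmetric] by (elim exE conjE)
  then show ?thesis using that[of V] openin_subset[of X V] by simp
qed

lemma t1: "t1_space X"
  unfolding t1_space_def
proof (intro ballI impI)
  fix x y assume xy: "x \<in> topspace X" "y \<in> topspace X" "x \<noteq> y"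
  show "\<exists>U. openin X U \<and> x \<in> U \<and> y \<notin> U"
  proof (cases "x \<sqsubset> y")
    case True
    then show ?thesis
      using openin_lower[OF xy(2)] xy by (intro exI[of _ "{z \<in> topspace X. z \<sqsubset> y}"]) simp
  next
    case False
    then have "y \<sqsubset> x" using xy(3) by order
    then show ?thesis
      using openin_upper[OF xy(2)] xy by (intro exI[of _ "{z \<in> topspace X. y \<sqsubset> z}"]) simp
  qed
qed

lemma closedin_upper:
  assumes "a \<in> topspace X"
  shows "closedin X {x \<in> topspace X. a \<sqsubseteq> x}"
proof -
  have "topspace X - {x \<in> topspace X. a \<sqsubseteq> x} = {x \<in> topspace X. x \<sqsubset> a}" by auto
  then show ?thesis unfolding closedin_def using openin_lower[OF assms] by auto
qed

lemma closedin_lower: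
  assumes "a \<in> topspace X"
  shows "closedin X {x \<in> topspace X. x \<sqsubseteq> a}"
proof -
  have "topspace X - {x \<in> topspace X. x \<sqsubseteq> a} = {x \<in> topspace X. a \<sqsubset> x}" by auto
  then show ?thesis unfolding closedin_def using openin_upper[OF assms] by auto
qed

text \<open>The endpoints come in either order. This makes being joined by a captured segment a
  symmetric relation and leaves segments unchanged when the order is reversed.\<close>

definition between :: "'a \<Rightarrow> 'a \<Rightarrow> 'a set" where
  "between x y = {z \<in> topspace X. x \<sqsubseteq> z \<and> z \<sqsubseteq> y \<or> y \<sqsubseteq> z \<and> z \<sqsubseteq> x}"

lemma between_commute: "between x y = between y x"
  by (auto simp: between_def)

lemma between_subset: "between x z \<subseteq> between x y \<union> between y z"
  by (auto simp: between_def)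

lemma between_dual: "ordered_go.between (\<lambda>x y. y \<sqsubseteq> x) X = between"
  by (intro ext) (auto simp: ordered_go.between_def[OF dual] between_def)

lemma order_convex_dual: "ordered_go.order_convex (\<lambda>x y. y \<sqsubseteq> x) X = order_convex"
  unfolding fun_eq_iff ordered_go.order_convex_def[OF dual] order_convex_def by meson

end

section \<open>From countable extent to exponential separability\<close>

context ordered_go
begin

text \<open>Any three distinct elements form a chain in one of six orders. The lemma turns a
  betweenness argument into finiteness: a convex set that contains no middle term cannot be met by
  both outer ones.\<close>

lemma finite_of_no_three:
  assumes "\<And>x y z. x \<in> T \<Longrightarrow> y \<in> T \<Longrightarrow> z \<in> T \<Longrightarrow> x \<sqsubset> y \<Longrightarrow> y \<sqsubset> z \<Longrightarrow> False"
  shows "finite T"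
proof (rule ccontr)
  assume inf: "infinite T"
  obtain x where x: "x \<in> T" using infinite_imp_nonempty[OF inf] by auto
  have "infinite (T - {x})" using inf by simp
  from infinite_imp_nonempty[OF this] obtain y where y: "y \<in> T" "y \<noteq> x" by auto
  have "infinite (T - {x, y})" using inf by simp
  from infinite_imp_nonempty[OF this] obtain z where z: "z \<in> T" "z \<noteq> x" "z \<noteq> y" by auto
  consider "x \<sqsubset> y" "y \<sqsubset> z" | "x \<sqsubset> z" "z \<sqsubset> y" | "y \<sqsubset> x" "x \<sqsubset> z"
    | "y \<sqsubset> z" "z \<sqsubset> x" | "z \<sqsubset> x" "x \<sqsubset> y" | "z \<sqsubset> y" "y \<sqsubset> x"
    using y z by (metis neqE)
  then show False
    by cases (rule assms; (rule x y z | assumption))+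
qed

text \<open>
  Suppose there is no common point. For each \<open>x\<close> take an increasing sequence \<open>s x\<close> above \<open>x\<close> that
  visits every member of the family infinitely often, with a strict upper bound \<open>nxt x\<close>. Zorn's
  lemma gives an uncountable set of \<open>x\<close> with pairwise separated sequences. A convex open set that
  misses some member cannot contain a whole sequence, nor infinitely many terms of one, so
  the union of these sequences is locally finite, contradicting countable extent.
\<close>

lemma closed_unbounded_sets_meet:
  assumes ce: "countable_extent X" and H: "closedin X H"
    and bdd: "\<And>Q. countable Q \<Longrightarrow> Q \<subseteq> H \<Longrightarrow> \<exists>b\<in>H. \<forall>q\<in>Q. q \<sqsubset> b"
    and F: "countable \<F>" "\<F> \<noteq> {}" "\<And>C. C \<in> \<F> \<Longrightarrow> closedin X C"
    and unb: "\<And>C b. C \<in> \<F> \<Longrightarrow> b \<in> H \<Longrightarrow> \<exists>y. y \<in> C \<and> y \<in> H \<and> b \<sqsubset> y"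
  shows "\<exists>p\<in>H. \<forall>C\<in>\<F>. p \<in> C"
proof (rule ccontr)
  assume contra: "\<not> (\<exists>p\<in>H. \<forall>C\<in>\<F>. p \<in> C)"
  have HX: "H \<subseteq> topspace X" using H by (rule closedin_subset)
  \<comment> \<open>The first component of the decoded pair selects a member of the family; the
    second is free, so each member recurs at arbitrarily large indices.\<close>
  define e where "e n = from_nat_into \<F> (fst (prod_decode n))" for n
  have e_in: "e n \<in> \<F>" for n unfolding e_def using F(2) by (rule from_nat_into)
  have e_often: "\<exists>n\<ge>m. e n = C" if C: "C \<in> \<F>" for C m
  proof -
    obtain k where "from_nat_into \<F> k = C" using from_nat_into_surj[OF F(1) C] by auto
    then show ?thesis
      by (intro exI[of _ "prod_encode (k, m)"]) (simp add: e_def le_prod_encode_2)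
  qed
  have "\<exists>s. \<forall>n. (s n \<in> e n \<and> s n \<in> H \<and> x \<sqsubset> s n) \<and> s n \<sqsubset> s (Suc n)" if x: "x \<in> H" for x
  proof (rule dependent_nat_choice[where P = "\<lambda>n y. y \<in> e n \<and> y \<in> H \<and> x \<sqsubset> y" and Q = "\<lambda>n y z. y \<sqsubset> z"])
    show "\<exists>y. y \<in> e 0 \<and> y \<in> H \<and> x \<sqsubset> y" using unb[OF e_in x] .
  next
    fix y n assume y: "y \<in> e n \<and> y \<in> H \<and> x \<sqsubset> y"
    then obtain z where z: "z \<in> e (Suc n)" "z \<in> H" "y \<sqsubset> z" using unb[OF e_in, of y] by auto
    have "x \<sqsubset> z" using y z(3) less_trans[of x y z] by simp
    then show "\<exists>z. (z \<in> e (Suc n) \<and> z \<in> H \<and> x \<sqsubset> z) \<and> y \<sqsubset> z" using z by (intro exI[of _ z]) simp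
  qed
  then obtain s where s: "\<And>x n. x \<in> H \<Longrightarrow> (s x n \<in> e n \<and> s x n \<in> H \<and> x \<sqsubset> s x n) \<and> s x n \<sqsubset> s x (Suc n)"
    by metis
  have s_mono: "s x n \<sqsubset> s x m" if "x \<in> H" "n < m" for x n m
    using that(2) by (induction rule: less_Suc_induct) (use s[OF that(1)] less_trans in auto)
  have "\<exists>b\<in>H. \<forall>n. s x n \<sqsubset> b" if "x \<in> H" for x
    using bdd[of "range (s x)"] s[OF that] by auto
  then obtain nxt where nxt: "\<And>x. x \<in> H \<Longrightarrow> nxt x \<in> H" "\<And>x n. x \<in> H \<Longrightarrow> s x n \<sqsubset> nxt x"
    by metis
  define \<T> where "\<T> = {T. T \<subseteq> H \<and> (\<forall>x\<in>T. \<forall>y\<in>T. x \<sqsubset> y \<longrightarrow> nxt x \<sqsubseteq> y)}"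
  have "\<exists>T\<in>\<T>. \<forall>T'\<in>\<T>. T \<subseteq> T' \<longrightarrow> T' = T"
  proof (rule subset_Zorn')
    fix c assume c: "subset.chain \<T> c"
    show "\<Union>c \<in> \<T>"
      unfolding \<T>_def
    proof (intro CollectI conjI ballI impI)
      show "\<Union>c \<subseteq> H" using c unfolding subset_chain_def \<T>_def by auto
    next
      fix x y assume xy: "x \<in> \<Union>c" "y \<in> \<Union>c" "x \<sqsubset> y"
      then obtain A B where AB: "A \<in> c" "x \<in> A" "B \<in> c" "y \<in> B" by auto
      then have "A \<subseteq> B \<or> B \<subseteq> A" using c unfolding subset_chain_def by auto
      then obtain D where "D \<in> c" "x \<in> D" "y \<in> D" using AB by auto
      moreover have "D \<in> \<T>" using c \<open>D \<in> c\<close> unfolding subset_chain_def by auto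
      ultimately show "nxt x \<sqsubseteq> y" using xy(3) unfolding \<T>_def by simp
    qed
  qed
  then obtain T where T: "T \<in> \<T>" "\<And>T'. T' \<in> \<T> \<Longrightarrow> T \<subseteq> T' \<Longrightarrow> T' = T" by metis
  have TH: "x \<in> H" if "x \<in> T" for x using T(1) that unfolding \<T>_def by auto
  have T_nxt: "nxt x \<sqsubseteq> y" if "x \<in> T" "y \<in> T" "x \<sqsubset> y" for x y
    using T(1) that unfolding \<T>_def by simp
  \<comment> \<open>A countable \<open>T\<close> would have a strict upper bound \<open>b\<close> in
    \<open>H\<close> that also exceeds all \<open>nxt x\<close>; adding \<open>b\<close> would
    contradict maximality.\<close>
  have "uncountable T"
  proof
    assume "countable T"
    then have "countable (T \<union> nxt ` T)" by simp
    moreover have "T \<union> nxt ` T \<subseteq> H" using TH nxt(1) by auto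
    ultimately obtain b where b: "b \<in> H" "\<And>q. q \<in> T \<Longrightarrow> q \<sqsubset> b" "\<And>q. q \<in> T \<Longrightarrow> nxt q \<sqsubset> b"
      using bdd[of "T \<union> nxt ` T"] by auto
    have "insert b T \<in> \<T>"
      unfolding \<T>_def
    proof (intro CollectI conjI ballI impI)
      show "insert b T \<subseteq> H" using b(1) TH by auto
    next
      fix x y assume xy: "x \<in> insert b T" "y \<in> insert b T" "x \<sqsubset> y"
      have "x \<noteq> b" using xy(2,3) b(2)[of y] by auto
      then have "x \<in> T" using xy(1) by simp
      then show "nxt x \<sqsubseteq> y" using xy(2,3) T_nxt b(3)[of x] by auto
    qed
    then have "b \<in> T" using T(2)[of "insert b T"] by auto
    then show False using b(2) by auto
  qed
  define E where "E = (\<Union>x\<in>T. range (s x))"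
  have EH: "E \<subseteq> H" unfolding E_def using s TH by auto
  have "countable E"
  proof (rule countable_extent_locally_finite[OF ce t1])
    show "E \<subseteq> topspace X" using EH HX by (rule subset_trans)
    fix p assume p: "p \<in> topspace X"
    show "\<exists>U. openin X U \<and> p \<in> U \<and> finite (E \<inter> U)"
    proof (cases "p \<in> H")
      case False
      have "E \<inter> (topspace X - H) = {}" using EH by auto
      then show ?thesis
        using False p H by (intro exI[of _ "topspace X - H"]) (simp add: openin_diff)
    next
      case True
      then obtain C where C: "C \<in> \<F>" "p \<notin> C" using contra by auto
      have oC: "openin X (topspace X - C)" using F(3)[OF C(1)] by (simp add: openin_diff)
      have pC: "p \<in> topspace X - C" using p C by simp
      obtain V where V: "openin X V" "p \<in> V" "V \<subseteq> topspace X - C" "order_convex V"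
        using convex_nbhd[OF oC pC] by metis
      have hit: "\<exists>k\<ge>m. s x k \<in> topspace X \<and> s x k \<notin> V" if x: "x \<in> H" for x m
      proof -
        obtain k where k: "k \<ge> m" "e k = C" using e_often[OF C(1)] by auto
        have "s x k \<in> C" "s x k \<in> H" using s[OF x, of k] k by auto
        then have "s x k \<in> topspace X" "s x k \<notin> V" using V(3) HX by auto
        then show ?thesis using k(1) by auto
      qed
      have fin: "finite (range (s x) \<inter> V)" if x: "x \<in> H" for x
      proof (cases "range (s x) \<inter> V = {}")
        case False
        then obtain n where n: "s x n \<in> V" by auto
        obtain k where k: "k \<ge> n" "s x k \<in> topspace X" "s x k \<notin> V" using hit[OF x] by metis
        have "s x m \<notin> V" if "k \<le> m" for m
        proof
          assume "s x m \<in> V"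
          moreover have "s x n \<sqsubseteq> s x k" "s x k \<sqsubseteq> s x m"
            using s_mono[OF x, of n k] s_mono[OF x, of k m] k(1) that
            by (auto simp: le_less nat_less_le)
          ultimately show False using order_convexD[OF V(4) n _ k(2)] k(3) by simp
        qed
        then have "m < k" if "s x m \<in> V" for m using that by (meson linorder_not_less)
        then have "range (s x) \<inter> V \<subseteq> s x ` {..<k}" by auto
        then show ?thesis by (rule finite_subset) simp
      qed simp
      have "finite {x \<in> T. range (s x) \<inter> V \<noteq> {}}"
      proof (rule finite_of_no_three)
        fix x y z
        assume "x \<in> {x \<in> T. range (s x) \<inter> V \<noteq> {}}" "y \<in> {x \<in> T. range (s x) \<inter> V \<noteq> {}}"
          "z \<in> {x \<in> T. range (s x) \<inter> V \<noteq> {}}" and lt: "x \<sqsubset> y" "y \<sqsubset> z"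
        then obtain i j where ij: "s x i \<in> V" "s z j \<in> V" and T3: "x \<in> T" "y \<in> T" "z \<in> T" by auto
        obtain k where k: "s y k \<in> topspace X" "s y k \<notin> V" using hit[OF TH[OF T3(2)]] by metis
        \<comment> \<open>By separation the whole sequence of \<open>y\<close> lies between any term
          for \<open>x\<close> and any term for \<open>z\<close>, so convexity would put the missing
          term \<open>s y k\<close> into \<open>V\<close>.\<close>
        have "s x i \<sqsubset> nxt x" "nxt x \<sqsubseteq> y" "y \<sqsubset> s y k" "s y k \<sqsubset> nxt y" "nxt y \<sqsubseteq> z" "z \<sqsubset> s z j"
          using nxt(2) TH T3 T_nxt lt s by simp_all
        then have "s x i \<sqsubseteq> s y k" "s y k \<sqsubseteq> s z j" by order+
        then show False using order_convexD[OF V(4) ij k(1)] k(2) by simp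
      qed
      then have "finite (\<Union>x\<in>{x \<in> T. range (s x) \<inter> V \<noteq> {}}. range (s x) \<inter> V)"
        using fin TH by (intro finite_UN_I) auto
      moreover have "E \<inter> V \<subseteq> (\<Union>x\<in>{x \<in> T. range (s x) \<inter> V \<noteq> {}}. range (s x) \<inter> V)"
        unfolding E_def by auto
      ultimately have "finite (E \<inter> V)" by (rule rev_finite_subset)
      then show ?thesis using V(1,2) by (intro exI[of _ V]) simp
    qed
  qed
  \<comment> \<open>The initial terms of separated sequences are distinct, so \<open>E\<close> is as
    uncountable as \<open>T\<close>.\<close>
  moreover have "inj_on (\<lambda>x. s x 0) T"
  proof (rule inj_onI, rule ccontr)
    have less: "s x 0 \<sqsubset> s y 0" if "x \<sqsubset> y" "x \<in> T" "y \<in> T" for x y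
    proof -
      have "s x 0 \<sqsubset> nxt x" "nxt x \<sqsubseteq> y" "y \<sqsubset> s y 0"
        using nxt(2) TH T_nxt s that by simp_all
      then show ?thesis by order
    qed
    fix x y assume "x \<in> T" "y \<in> T" "s x 0 = s y 0" "x \<noteq> y"
    then show False using less[of x y] less[of y x] by (cases rule: linorder_cases[of x y]) auto
  qed
  moreover have "(\<lambda>x. s x 0) ` T \<subseteq> E" unfolding E_def by auto
  ultimately show False
    using \<open>uncountable T\<close> countable_image_inj_on countable_subset by metis
qed

lemma between_subset_convex:
  assumes "order_convex V" "a \<in> V" "b \<in> V"
  shows "between a b \<subseteq> V"
proof
  fix z assume "z \<in> between a b"
  then have z: "z \<in> topspace X" "a \<sqsubseteq> z \<and> z \<sqsubseteq> b \<or> b \<sqsubseteq> z \<and> z \<sqsubseteq> a"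
    by (simp_all add: between_def)
  from z(2) show "z \<in> V"
    using order_convexD[OF assms z(1)] order_convexD[OF assms(1,3,2) z(1)] by (elim disjE conjE)
qed

section \<open>Capturing half-lines and whole spaces\<close>

text \<open>If \<open>H\<close> has a countable cofinal subset, countably many captured segments
  cover it. Otherwise closed sets unbounded in \<open>H\<close> behave like closed unbounded subsets
  of an ordinal of uncountable cofinality, and countably many of them have a common point.\<close>

lemma captured_upward:
  assumes ce: "countable_extent X" and H: "closedin X H" and d: "d \<in> H"
    and dH: "\<And>x. x \<in> H \<Longrightarrow> d \<sqsubseteq> x"
    and seg: "\<And>x. x \<in> H \<Longrightarrow> captured X \<F> (between d x)"
    and F: "countable \<F>" "\<And>C. C \<in> \<F> \<Longrightarrow> closedin X C"
  shows "captured X \<F> H"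
proof (cases "\<exists>Q\<subseteq>H. countable Q \<and> (\<forall>b\<in>H. \<exists>q\<in>Q. b \<sqsubseteq> q)")
  case True
  then obtain Q where Q: "Q \<subseteq> H" "countable Q" "\<forall>b\<in>H. \<exists>q\<in>Q. b \<sqsubseteq> q" by (elim exE conjE)
  have "captured X \<F> (\<Union>q\<in>Q. between d q)"
    using captured_UN[OF Q(2), of X \<F> "between d"] seg Q(1) by (simp add: subset_iff)
  moreover have "H \<subseteq> (\<Union>q\<in>Q. between d q)"
  proof
    fix b assume b: "b \<in> H"
    then obtain q where "q \<in> Q" "b \<sqsubseteq> q" using bspec[OF Q(3) b] by (elim bexE)
    then show "b \<in> (\<Union>q\<in>Q. between d q)"
      using b dH[OF b] closedin_subset[OF H] by (auto simp: between_def)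
  qed
  ultimately show ?thesis by (rule captured_subset)
next
  case False
  have bdd: "\<exists>b\<in>H. \<forall>q\<in>Q. q \<sqsubset> b" if Q: "countable Q" "Q \<subseteq> H" for Q
  proof (rule ccontr)
    assume "\<not> (\<exists>b\<in>H. \<forall>q\<in>Q. q \<sqsubset> b)"
    then have "\<forall>b\<in>H. \<exists>q\<in>Q. b \<sqsubseteq> q" by (simp add: not_less)
    then have "\<exists>Q\<subseteq>H. countable Q \<and> (\<forall>b\<in>H. \<exists>q\<in>Q. b \<sqsubseteq> q)"
      using Q by (intro exI[of _ Q] conjI)
    then show False by (rule notE[OF False])
  qed
  define \<U> where "\<U> = {C \<in> \<F>. \<forall>b\<in>H. \<exists>y. y \<in> C \<and> y \<in> H \<and> b \<sqsubset> y}"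
  have "\<exists>p\<in>H. \<forall>C\<in>\<U>. p \<in> C"
  proof (cases "\<U> = {}")
    case True
    \<comment> \<open>With no unbounded member any point of \<open>H\<close> will do;
      \<open>closed_unbounded_sets_meet\<close> asks for a nonempty family.\<close>
    then show ?thesis using d by (intro bexI[of _ d]) simp_all
  next
    case False
    show ?thesis
    proof (rule closed_unbounded_sets_meet[OF ce H bdd _ False])
      show "countable \<U>" unfolding \<U>_def using F(1) by simp
    qed (simp_all add: \<U>_def F(2))
  qed
  then obtain p where p: "p \<in> H" "\<And>C. C \<in> \<U> \<Longrightarrow> p \<in> C" by auto
  have "\<exists>b\<in>H. \<forall>y. y \<in> C \<longrightarrow> y \<in> H \<longrightarrow> y \<sqsubseteq> b" if "C \<in> \<F> - \<U>" for C
    using that unfolding \<U>_def by (auto simp: not_less)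
  then obtain \<beta> where \<beta>: "\<And>C. C \<in> \<F> - \<U> \<Longrightarrow> \<beta> C \<in> H"
      "\<And>C y. C \<in> \<F> - \<U> \<Longrightarrow> y \<in> C \<Longrightarrow> y \<in> H \<Longrightarrow> y \<sqsubseteq> \<beta> C"
    by metis
  have "countable (\<beta> ` (\<F> - \<U>))" "\<beta> ` (\<F> - \<U>) \<subseteq> H"
    using F(1) \<beta>(1) by auto
  then obtain b where b: "b \<in> H" "\<And>C. C \<in> \<F> - \<U> \<Longrightarrow> \<beta> C \<sqsubset> b"
    using bdd[of "\<beta> ` (\<F> - \<U>)"] by auto
  \<comment> \<open>Beyond \<open>b\<close>, which exceeds the bounds of all members outside
    \<open>\<U>\<close>, a point of \<open>H\<close> lies only in members from \<open>\<U>\<close>,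
    and \<open>p\<close> belongs to all of these.\<close>
  have "captured X \<F> {y \<in> H. b \<sqsubset> y}"
  proof (rule captured_by_point)
    show "p \<in> topspace X" using p(1) closedin_subset[OF H] by (rule rev_subsetD)
    fix y C assume y: "y \<in> {y \<in> H. b \<sqsubset> y}" and C: "C \<in> \<F>" "y \<in> C"
    have "C \<in> \<U>"
    proof (rule ccontr)
      assume "C \<notin> \<U>"
      then have "y \<sqsubseteq> \<beta> C" "\<beta> C \<sqsubset> b" using y C \<beta>(2)[of C y] b(2)[of C] by simp_all
      moreover have "b \<sqsubset> y" using y by simp
      ultimately show False by order
    qed
    then show "p \<in> C" by (rule p(2))
  qed
  then have "captured X \<F> (between d b \<union> {y \<in> H. b \<sqsubset> y})"
    using seg[OF b(1)] by (intro captured_Un)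
  moreover have "H \<subseteq> between d b \<union> {y \<in> H. b \<sqsubset> y}"
    using dH closedin_subset[OF H] by (auto simp: between_def not_less)
  ultimately show ?thesis by (rule captured_subset)
qed

lemma captured_downward:
  assumes "countable_extent X" "closedin X H" "d \<in> H"
    and "\<And>x. x \<in> H \<Longrightarrow> x \<sqsubseteq> d"
    and "\<And>x. x \<in> H \<Longrightarrow> captured X \<F> (between d x)"
    and "countable \<F>" "\<And>C. C \<in> \<F> \<Longrightarrow> closedin X C"
  shows "captured X \<F> H"
  by (rule ordered_go.captured_upward[OF dual assms(1-3), unfolded between_dual])
    (simp_all add: assms)

text \<open>Being joined by a captured segment is an equivalence relation. Local capture makes its
  classes open, hence also closed. Each class is then an open set with a single representative, so
  the representatives form a locally finite set and there are countably many classes.\<close>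

lemma locally_captured_imp_captured:
  assumes ce: "countable_extent X"
    and F: "countable \<F>" "\<And>C. C \<in> \<F> \<Longrightarrow> closedin X C"
    and loc: "\<And>x. x \<in> topspace X \<Longrightarrow> \<exists>U. openin X U \<and> x \<in> U \<and> captured X \<F> U"
  shows "captured X \<F> (topspace X)"
proof -
  define cls where "cls x = {y \<in> topspace X. captured X \<F> (between x y)}" for x
  have cls_refl: "x \<in> cls x" if "x \<in> topspace X" for x
  proof -
    have "between x x \<subseteq> {x}" unfolding between_def by auto
    then have "captured X \<F> (between x x)"
      using captured_subset[OF captured_countable[of "{x}" X \<F>]] that by simp
    then show ?thesis using that unfolding cls_def by simp
  qed
  have cls_sym: "x \<in> cls y" if "y \<in> cls x" "x \<in> topspace X" for x y
    using that unfolding cls_def by (simp add: between_commute[of x y])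
  have cls_trans: "z \<in> cls x" if "y \<in> cls x" "z \<in> cls y" for x y z
    using that captured_subset[OF captured_Un between_subset, of X \<F> x y z]
    unfolding cls_def by simp
  have cls_X: "cls x \<subseteq> topspace X" for x unfolding cls_def by auto
  have cls_nbhd: "\<exists>V. openin X V \<and> y \<in> V \<and> V \<subseteq> cls y" if y: "y \<in> topspace X" for y
  proof -
    obtain U where U: "openin X U" "y \<in> U" "captured X \<F> U" using loc[OF y] by (elim exE conjE)
    obtain V where V: "openin X V" "y \<in> V" "V \<subseteq> U" "V \<subseteq> topspace X" "order_convex V"
      by (rule convex_nbhd[OF U(1,2)])
    have "V \<subseteq> cls y"
    proof
      fix z assume z: "z \<in> V"
      have "between y z \<subseteq> V" using V(5,2) z by (rule between_subset_convex)
      then have "between y z \<subseteq> U" using V(3) by (rule subset_trans)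
      then show "z \<in> cls y"
        unfolding cls_def using captured_subset[OF U(3)] subsetD[OF V(4) z] by simp
    qed
    then show ?thesis using V(1,2) by (intro exI[of _ V]) simp
  qed
  have cls_open: "openin X (cls x)" for x
  proof (subst openin_subopen, rule ballI)
    fix y assume y: "y \<in> cls x"
    then have "y \<in> topspace X" using cls_X by (rule rev_subsetD)
    from cls_nbhd[OF this] obtain V where V: "openin X V" "y \<in> V" "V \<subseteq> cls y"
      by (elim exE conjE)
    have "V \<subseteq> cls x" using V(3) cls_trans[OF y] by auto
    then show "\<exists>T. openin X T \<and> y \<in> T \<and> T \<subseteq> cls x" using V by (intro exI[of _ V]) simp
  qed
  have cls_closed: "closedin X (cls x)" if x: "x \<in> topspace X" for x
    unfolding closedin_def
  proof
    show "openin X (topspace X - cls x)"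
    proof (subst openin_subopen, rule ballI)
      fix y assume y: "y \<in> topspace X - cls x"
      have "z \<notin> cls x" if z: "z \<in> cls y" for z
      proof
        assume "z \<in> cls x"
        moreover have "y \<in> cls z" using cls_sym[OF z] y by simp
        ultimately have "y \<in> cls x" by (rule cls_trans)
        then show False using y by simp
      qed
      then have "cls y \<subseteq> topspace X - cls x" using cls_X[of y] by auto
      then show "\<exists>T. openin X T \<and> y \<in> T \<and> T \<subseteq> topspace X - cls x"
        using cls_open[of y] cls_refl[of y] y by (intro exI[of _ "cls y"]) simp
    qed
  qed (rule cls_X)
  have cls_eq: "cls y = cls x" if "y \<in> cls x" "x \<in> topspace X" for x y
    using cls_trans[OF that(1)] cls_trans[OF cls_sym[OF that]] by auto
  \<comment> \<open>The choice depends only on the set \<open>cls x\<close>, so points of one class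
    receive the same representative.\<close>
  define rep where "rep x = (SOME y. y \<in> cls x)" for x
  have rep: "rep x \<in> cls x" if "x \<in> topspace X" for x
    unfolding rep_def by (rule someI[of "\<lambda>y. y \<in> cls x"]) (rule cls_refl[OF that])
  have rep_eq: "rep y = rep x" if "y \<in> cls x" "x \<in> topspace X" for x y
    using cls_eq[OF that] by (simp add: rep_def)
  define D where "D = rep ` topspace X"
  have DX: "D \<subseteq> topspace X" unfolding D_def using rep cls_X by auto
  have "countable D"
  proof (rule countable_extent_locally_finite[OF ce t1 DX])
    fix x assume x: "x \<in> topspace X"
    have "D \<inter> cls x \<subseteq> {rep x}"
    proof
      fix w assume w: "w \<in> D \<inter> cls x"
      then obtain z where z: "z \<in> topspace X" "w = rep z" unfolding D_def by auto
      have "rep w = rep z" using rep_eq[OF rep[OF z(1)] z(1)] z(2) by simp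
      moreover have "rep w = rep x" using rep_eq[of w x] w x by simp
      ultimately show "w \<in> {rep x}" using z(2) by simp
    qed
    then have "finite (D \<inter> cls x)" by (rule finite_subset) simp
    then show "\<exists>U. openin X U \<and> x \<in> U \<and> finite (D \<inter> U)"
      using cls_open[of x] cls_refl[OF x] by (intro exI[of _ "cls x"]) simp
  qed
  moreover have "captured X \<F> (cls d)" if "d \<in> D" for d
  proof -
    have d: "d \<in> topspace X" using that DX by (rule rev_subsetD)
    \<comment> \<open>The class is split at \<open>d\<close>, because the one-directional lemmas
      need a closed set with \<open>d\<close> as an endpoint.\<close>
    have up: "captured X \<F> (cls d \<inter> {x \<in> topspace X. d \<sqsubseteq> x})"
    proof (rule captured_upward[where d = d, OF ce _ _ _ _ F])
      show "closedin X (cls d \<inter> {x \<in> topspace X. d \<sqsubseteq> x})"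
        using cls_closed[OF d] closedin_upper[OF d] by (rule closedin_Int)
    qed (use d cls_refl[OF d] in \<open>simp_all add: cls_def\<close>)
    have down: "captured X \<F> (cls d \<inter> {x \<in> topspace X. x \<sqsubseteq> d})"
    proof (rule captured_downward[where d = d, OF ce _ _ _ _ F])
      show "closedin X (cls d \<inter> {x \<in> topspace X. x \<sqsubseteq> d})"
        using cls_closed[OF d] closedin_lower[OF d] by (rule closedin_Int)
    qed (use d cls_refl[OF d] in \<open>simp_all add: cls_def\<close>)
    have "cls d \<subseteq>
        cls d \<inter> {x \<in> topspace X. d \<sqsubseteq> x} \<union> cls d \<inter> {x \<in> topspace X. x \<sqsubseteq> d}"
      using cls_X[of d] linear by auto
    then show ?thesis by (rule captured_subset[OF captured_Un[OF up down]])
  qed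
  ultimately have "captured X \<F> (\<Union>d\<in>D. cls d)" by (rule captured_UN)
  moreover have "topspace X \<subseteq> (\<Union>d\<in>D. cls d)"
  proof
    fix x assume x: "x \<in> topspace X"
    then show "x \<in> (\<Union>d\<in>D. cls d)"
      using cls_sym[OF rep[OF x] x] unfolding D_def by auto
  qed
  ultimately show ?thesis by (rule captured_subset)
qed

section \<open>Isolated exceptional points and the scattered case\<close>

text \<open>Unless \<open>x\<close> is last in some neighbourhood, choose \<open>u\<close> beyond
  \<open>x\<close> in \<open>V\<close>. Segments from a point beyond \<open>x\<close> up to
  \<open>u\<close> avoid \<open>x\<close> and are captured. If countably many of them exhaust the
  points after \<open>x\<close>, these suffice. Otherwise the countably many members missing
  \<open>x\<close> all avoid a common initial piece after \<open>x\<close>, which is captured by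
  \<open>x\<close> itself.\<close>

lemma captured_right_nbhd:
  assumes ce: "countable_extent X"
    and V: "openin X V" "order_convex V" and x: "x \<in> V"
    and loc: "\<And>y. y \<in> V \<Longrightarrow> y \<noteq> x \<Longrightarrow> \<exists>U. openin X U \<and> y \<in> U \<and> captured_always X U"
  shows "\<exists>W. openin X W \<and> x \<in> W \<and> captured_always X {y \<in> W. x \<sqsubseteq> y}"
proof (cases "\<exists>W. openin X W \<and> x \<in> W \<and> (\<forall>y\<in>W. y \<sqsubseteq> x)")
  case True
  then obtain W where W: "openin X W" "x \<in> W" "\<forall>y\<in>W. y \<sqsubseteq> x" by (elim exE conjE)
  have "{y \<in> W. x \<sqsubseteq> y} \<subseteq> {x}" using W(3) by auto
  moreover have "x \<in> topspace X" using W(1,2) openin_subset[OF W(1)] by auto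
  ultimately have "captured X \<F> {y \<in> W. x \<sqsubseteq> y}" for \<F>
    using captured_subset[OF captured_countable[of "{x}" X \<F>]] by simp
  then show ?thesis using W(1,2) unfolding captured_always_def by (intro exI[of _ W]) simp
next
  case False
  have VX: "V \<subseteq> topspace X" using V(1) by (rule openin_subset)
  have right: "\<exists>w\<in>W. x \<sqsubset> w" if "openin X W" "x \<in> W" for W
    using False that by (auto simp: not_le)
  obtain u where u: "u \<in> V" "x \<sqsubset> u" using right[OF V(1) x] by (elim bexE)
  have uX: "u \<in> topspace X" and xX: "x \<in> topspace X" using u(1) x VX by auto
  define J where "J = {y \<in> topspace X. x \<sqsubset> y \<and> y \<sqsubseteq> u}"
  have "captured X \<F> J" if F: "countable \<F>" "\<forall>C\<in>\<F>. closedin X C" for \<F>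
  proof -
    have seg: "captured X \<F> {y \<in> topspace X. v \<sqsubseteq> y \<and> y \<sqsubseteq> u}" (is "captured X \<F> ?K") if v: "v \<in> J" for v
    proof -
      have vX: "v \<in> topspace X" and xv: "x \<sqsubset> v" using v unfolding J_def by simp_all
      have "?K = {y \<in> topspace X. v \<sqsubseteq> y} \<inter> {y \<in> topspace X. y \<sqsubseteq> u}" by auto
      then have K: "closedin X ?K"
        using closedin_Int[OF closedin_upper[OF vX] closedin_lower[OF uX]] by simp
      \<comment> \<open>The closed segment inherits the order axioms and countable extent, and none
        of its points is \<open>x\<close>, so the result for whole spaces applies inside it.\<close>
      have "captured (subtopology X ?K) ((\<lambda>C. ?K \<inter> C) ` \<F>) (topspace (subtopology X ?K))"
      proof (rule ordered_go.locally_captured_imp_captured[OF subspace countable_extent_closed_subspace[OF ce K]])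
        show "countable ((\<lambda>C. ?K \<inter> C) ` \<F>)" using F(1) by simp
      next
        fix C assume "C \<in> (\<lambda>C. ?K \<inter> C) ` \<F>"
        then obtain C' where "C' \<in> \<F>" "C = C' \<inter> ?K" by auto
        then show "closedin (subtopology X ?K) C"
          using F(2) unfolding closedin_subtopology by (intro exI[of _ C']) simp
      next
        fix y assume "y \<in> topspace (subtopology X ?K)"
        then have y: "y \<in> ?K" by simp
        then have "x \<sqsubseteq> y" "y \<sqsubseteq> u" "y \<noteq> x" using xv by auto
        then have "y \<in> V" using order_convexD[OF V(2) x u(1)] y by simp
        from loc[OF this \<open>y \<noteq> x\<close>]
        obtain U where U: "openin X U" "y \<in> U" "captured_always X U"
          by (elim exE conjE)
        have "captured X (insert ?K \<F>) U"
          using U(3) by (rule captured_alwaysD) (use F K in auto)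
        then have "captured X (insert ?K \<F>) (U \<inter> ?K)" by (rule captured_subset) simp
        then have "captured (subtopology X ?K) ((\<lambda>C. ?K \<inter> C) ` \<F>) (U \<inter> ?K)"
          by (rule captured_into_subspace) simp
        then show "\<exists>U. openin (subtopology X ?K) U \<and> y \<in> U \<and>
            captured (subtopology X ?K) ((\<lambda>C. ?K \<inter> C) ` \<F>) U"
          using openin_subtopology_Int[OF U(1), of ?K] U(2) y by (intro exI[of _ "U \<inter> ?K"]) simp
      qed
      moreover have "topspace (subtopology X ?K) = ?K" by auto
      ultimately have "captured (subtopology X ?K) ((\<lambda>C. ?K \<inter> C) ` \<F>) ?K" by simp
      then show ?thesis by (rule captured_subspace) simp
    qed
    show ?thesis
    proof (cases "\<exists>Q\<subseteq>J. countable Q \<and> (\<forall>b\<in>J. \<exists>q\<in>Q. q \<sqsubseteq> b)")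
      case True
      then obtain Q where Q: "Q \<subseteq> J" "countable Q" "\<forall>b\<in>J. \<exists>q\<in>Q. q \<sqsubseteq> b" by (elim exE conjE)
      have "captured X \<F> (\<Union>q\<in>Q. {y \<in> topspace X. q \<sqsubseteq> y \<and> y \<sqsubseteq> u})"
        by (rule captured_UN[OF Q(2)]) (rule seg[OF subsetD[OF Q(1)]])
      moreover have "J \<subseteq> (\<Union>q\<in>Q. {y \<in> topspace X. q \<sqsubseteq> y \<and> y \<sqsubseteq> u})"
      proof
        fix b assume b: "b \<in> J"
        then obtain q where "q \<in> Q" "q \<sqsubseteq> b" using bspec[OF Q(3) b] by (elim bexE)
        then show "b \<in> (\<Union>q\<in>Q. {y \<in> topspace X. q \<sqsubseteq> y \<and> y \<sqsubseteq> u})"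
          using b unfolding J_def by auto
      qed
      ultimately show ?thesis by (rule captured_subset)
    next
      case unbounded: False
      have bdd: "\<exists>b\<in>J. \<forall>q\<in>Q. b \<sqsubset> q" if Q: "countable Q" "Q \<subseteq> J" for Q
      proof (rule ccontr)
        assume "\<not> (\<exists>b\<in>J. \<forall>q\<in>Q. b \<sqsubset> q)"
        then have "\<forall>b\<in>J. \<exists>q\<in>Q. q \<sqsubseteq> b" by (simp add: not_less)
        then have "\<exists>Q\<subseteq>J. countable Q \<and> (\<forall>b\<in>J. \<exists>q\<in>Q. q \<sqsubseteq> b)"
          using Q by (intro exI[of _ Q] conjI)
        then show False by (rule notE[OF unbounded])
      qed
      \<comment> \<open>A member that misses \<open>x\<close> also misses a neighbourhood of
        \<open>x\<close>, hence an initial piece of \<open>J\<close>.\<close>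
      let ?G = "{C \<in> \<F>. x \<notin> C}"
      have "\<exists>q\<in>J. \<forall>y\<in>J. y \<sqsubset> q \<longrightarrow> y \<notin> C" if C: "C \<in> ?G" for C
      proof -
        have o: "openin X (topspace X - C)" using C F(2) by (simp add: openin_diff)
        have "x \<in> topspace X - C" using C xX by simp
        then obtain W where W: "openin X W" "x \<in> W" "W \<subseteq> topspace X - C" "W \<subseteq> topspace X" "order_convex W"
          by (rule convex_nbhd[OF o])
        obtain w where w: "w \<in> W" "x \<sqsubset> w" using right[OF W(1,2)] by (elim bexE)
        have wX: "w \<in> topspace X" using w(1) W(4) by (rule rev_subsetD)
        \<comment> \<open>The minimum of \<open>w\<close> and \<open>u\<close>, since
          \<open>w\<close> may lie beyond \<open>u\<close> and so outside \<open>J\<close>.\<close>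
        define q where "q = (if w \<sqsubseteq> u then w else u)"
        have "q \<in> J" unfolding q_def J_def using w(2) wX u(2) uX by simp
        moreover have "q \<sqsubseteq> w" unfolding q_def using linear by auto
        have "y \<notin> C" if "y \<in> J" "y \<sqsubset> q" for y
        proof -
          have "x \<sqsubset> y" "y \<in> topspace X" using that(1) unfolding J_def by simp_all
          moreover have "y \<sqsubseteq> w" using that(2) \<open>q \<sqsubseteq> w\<close> by order
          ultimately have "y \<in> W" using order_convexD[OF W(5,2) w(1), of y] by simp
          then show ?thesis using W(3) by auto
        qed
        ultimately show ?thesis by (intro bexI[of _ q]) simp_all
      qed
      then obtain \<beta> where \<beta>: "\<And>C. C \<in> ?G \<Longrightarrow> \<beta> C \<in> J"
          "\<And>C y. C \<in> ?G \<Longrightarrow> y \<in> J \<Longrightarrow> y \<sqsubset> \<beta> C \<Longrightarrow> y \<notin> C"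
        by metis
      have "countable (\<beta> ` ?G)" "\<beta> ` ?G \<subseteq> J" using F(1) \<beta>(1) by auto
      then have "\<exists>b\<in>J. \<forall>q\<in>\<beta> ` ?G. b \<sqsubset> q" by (rule bdd)
      then obtain b where b: "b \<in> J" "\<forall>q\<in>\<beta> ` ?G. b \<sqsubset> q" by (elim bexE)
      have "captured X \<F> {y \<in> J. y \<sqsubset> b}"
      proof (rule captured_by_point[OF xX], rule ccontr)
        fix y C assume y: "y \<in> {y \<in> J. y \<sqsubset> b}" and C: "C \<in> \<F>" "y \<in> C" "x \<notin> C"
        then have "b \<sqsubset> \<beta> C" "y \<sqsubset> b" using b(2) by auto
        then have "y \<sqsubset> \<beta> C" by order
        then show False using \<beta>(2)[of C y] C y by simp
      qed
      then have "captured X \<F> ({y \<in> topspace X. b \<sqsubseteq> y \<and> y \<sqsubseteq> u} \<union> {y \<in> J. y \<sqsubset> b})"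
        using seg[OF b(1)] by (intro captured_Un)
      moreover have "J \<subseteq> {y \<in> topspace X. b \<sqsubseteq> y \<and> y \<sqsubseteq> u} \<union> {y \<in> J. y \<sqsubset> b}"
        by (auto simp: J_def not_less)
      ultimately show ?thesis by (rule captured_subset)
    qed
  qed
  then have J: "captured X \<F> ({x} \<union> J)" if "countable \<F>" "\<forall>C\<in>\<F>. closedin X C" for \<F>
    using captured_Un[OF captured_countable[of "{x}" X \<F>]] that xX by simp
  have "{y \<in> V \<inter> {y \<in> topspace X. y \<sqsubset> u}. x \<sqsubseteq> y} \<subseteq> {x} \<union> J"
    unfolding J_def by (auto simp: le_less)
  then have "captured_always X {y \<in> V \<inter> {y \<in> topspace X. y \<sqsubset> u}. x \<sqsubseteq> y}"
    unfolding captured_always_def using captured_subset[OF J] by simp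
  moreover have "openin X (V \<inter> {y \<in> topspace X. y \<sqsubset> u})"
    using V(1) openin_lower[OF uX] by (rule openin_Int)
  ultimately show ?thesis
    using x xX u(2) by (intro exI[of _ "V \<inter> {y \<in> topspace X. y \<sqsubset> u}"]) simp
qed

lemma captured_left_nbhd:
  assumes "countable_extent X" "openin X V" "order_convex V" "x \<in> V"
    and "\<And>y. y \<in> V \<Longrightarrow> y \<noteq> x \<Longrightarrow> \<exists>U. openin X U \<and> y \<in> U \<and> captured_always X U"
  shows "\<exists>W. openin X W \<and> x \<in> W \<and> captured_always X {y \<in> W. y \<sqsubseteq> x}"
  using assms by (rule ordered_go.captured_right_nbhd[OF dual, unfolded order_convex_dual])

text \<open>If the set \<open>S\<close> of exceptional points were nonempty, it would have an
  isolated point \<open>s\<close>. Near \<open>s\<close> all other points have captured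
  neighbourhoods, so both one-sided lemmas apply at \<open>s\<close>, and the union of the two sides
  contains a neighbourhood of \<open>s\<close>.\<close>

lemma scattered_imp_locally_captured:
  assumes ce: "countable_extent X" and sc: "scattered_space X" and x: "x \<in> topspace X"
  shows "\<exists>U. openin X U \<and> x \<in> U \<and> captured_always X U"
proof (rule ccontr)
  assume no: "\<not> (\<exists>U. openin X U \<and> x \<in> U \<and> captured_always X U)"
  define S where "S = {x \<in> topspace X. \<not> (\<exists>U. openin X U \<and> x \<in> U \<and> captured_always X U)}"
  have "x \<in> S" unfolding S_def using no x by simp
  then have "S \<subseteq> topspace X \<and> S \<noteq> {}" unfolding S_def by auto
  then obtain s where s: "s \<in> S" "openin (subtopology X S) {s}"
    using sc[unfolded scattered_space_def, rule_format, of S] by auto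
  obtain U where U: "openin X U" "{s} = U \<inter> S" using s(2) unfolding openin_subtopology by auto
  then have "s \<in> U" by auto
  then obtain V where V: "openin X V" "s \<in> V" "V \<subseteq> U" "V \<subseteq> topspace X" "order_convex V"
    by (rule convex_nbhd[OF U(1)])
  have loc: "\<exists>U. openin X U \<and> y \<in> U \<and> captured_always X U" if y: "y \<in> V" "y \<noteq> s" for y
  proof -
    have "y \<notin> S" using y V(3) U(2) by auto
    then show ?thesis using y(1) V(4) unfolding S_def by auto
  qed
  obtain W1 where W1: "openin X W1" "s \<in> W1" "captured_always X {y \<in> W1. s \<sqsubseteq> y}"
    using captured_right_nbhd[OF ce V(1,5,2) loc] by auto
  obtain W2 where W2: "openin X W2" "s \<in> W2" "captured_always X {y \<in> W2. y \<sqsubseteq> s}"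
    using captured_left_nbhd[OF ce V(1,5,2) loc] by auto
  have sub: "W1 \<inter> W2 \<subseteq> {y \<in> W1. s \<sqsubseteq> y} \<union> {y \<in> W2. y \<sqsubseteq> s}" using linear by auto
  have "captured_always X (W1 \<inter> W2)"
    using W1(3) W2(3) captured_subset[OF captured_Un sub]
    unfolding captured_always_def by simp
  moreover have "openin X (W1 \<inter> W2)" using W1(1) W2(1) by (rule openin_Int)
  ultimately have "\<exists>U. openin X U \<and> s \<in> U \<and> captured_always X U"
    using W1(2) W2(2) by (intro exI[of _ "W1 \<inter> W2"]) simp
  moreover have "\<not> (\<exists>U. openin X U \<and> s \<in> U \<and> captured_always X U)"
    using s(1) unfolding S_def mem_Collect_eq by (rule conjunct2)
  ultimately show False by (rule notE[rotated])
qed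

lemma countable_extent_imp_exponentially_separable:
  assumes ce: "countable_extent X" and "scattered_space X \<or> locally_countable_space X"
  shows "exponentially_separable X"
proof -
  have loc: "\<exists>U. openin X U \<and> x \<in> U \<and> captured_always X U" if x: "x \<in> topspace X" for x
    using assms(2)
  proof
    assume "scattered_space X"
    then show ?thesis using scattered_imp_locally_captured[OF ce _ x] by simp
  next
    assume "locally_countable_space X"
    then obtain N U where U: "countable N" "openin X U" "x \<in> U" "U \<subseteq> N"
      using x unfolding locally_countable_space_def by auto
    have "countable U" using U(4,1) by (rule countable_subset)
    then have "captured_always X U"
      using captured_countable openin_subset[OF U(2)] unfolding captured_always_def by auto
    then show ?thesis using U by (intro exI[of _ U]) simp
  qed
  show ?thesis
    unfolding exponentially_separable_iff_captured
  proof (intro allI impI, elim conjE)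
    fix \<F> assume F: "countable \<F>" "\<forall>C\<in>\<F>. closedin X C"
    show "captured X \<F> (topspace X)"
    proof (rule locally_captured_imp_captured[OF ce F(1)])
      show "closedin X C" if "C \<in> \<F>" for C using F(2) that by simp
      fix x assume "x \<in> topspace X"
      then obtain U where "openin X U" "x \<in> U" "captured_always X U" using loc by auto
      then show "\<exists>U. openin X U \<and> x \<in> U \<and> captured X \<F> U"
        using F unfolding captured_always_def by (intro exI[of _ U]) simp
    qed
  qed
qed

end

section \<open>Normality\<close>

context ordered_go
begin

text \<open>
  Separating closed sets \<open>A\<close> and \<open>B\<close>: \<open>pt\<close> selects a point in each convex component of the
  complement of \<open>A \<union> B\<close>. A neighbourhood of \<open>a \<in> A\<close> may enter such a component only up to the selected
  point, so it cannot meet a neighbourhood that enters the component from a point of \<open>B\<close>.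
\<close>

lemma right_separating_nbhd:
  assumes B: "closedin X B" and a: "a \<in> topspace X" "a \<in> A" "a \<notin> B"
    and pt_X: "\<And>z. z \<in> topspace X \<Longrightarrow> pt z \<in> topspace X"
    and pt_between: "\<And>z. z \<in> topspace X - (A \<union> B) \<Longrightarrow> between z (pt z) \<inter> (A \<union> B) = {}"
    and pt_eq: "\<And>z w. z \<in> topspace X \<Longrightarrow> w \<in> topspace X \<Longrightarrow> between z w \<inter> (A \<union> B) = {} \<Longrightarrow> pt z = pt w"
  shows "\<exists>V. openin X V \<and> a \<in> V \<and> order_convex V \<and> V \<inter> B = {} \<and>
    (\<forall>z\<in>V. a \<sqsubset> z \<longrightarrow> z \<sqsubset> pt z \<or> (\<exists>a'\<in>A. z \<sqsubseteq> a' \<and> between a a' \<inter> B = {}))"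
proof -
  have o: "openin X (topspace X - B)" using B by (simp add: openin_diff)
  have "a \<in> topspace X - B" using a by simp
  then obtain V where V: "openin X V" "a \<in> V" "V \<subseteq> topspace X - B" "V \<subseteq> topspace X" "order_convex V"
    by (rule convex_nbhd[OF o])
  have VB: "V \<inter> B = {}" using V(3) by auto
  \<comment> \<open>It suffices to cut \<open>V\<close> off at some \<open>p\<close> beyond
    \<open>a\<close>. The cut is made at a further point of \<open>A\<close> in \<open>V\<close> if
    there is one, and otherwise at the selected point of the component entered.\<close>
  have cut: ?thesis if p: "p \<in> topspace X" "a \<sqsubset> p"
    and ok: "\<And>z. z \<in> V \<Longrightarrow> z \<sqsubset> p \<Longrightarrow> a \<sqsubset> z \<Longrightarrow>
      z \<sqsubset> pt z \<or> (\<exists>a'\<in>A. z \<sqsubseteq> a' \<and> between a a' \<inter> B = {})" for p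
  proof (intro exI[of _ "V \<inter> {x \<in> topspace X. x \<sqsubset> p}"] conjI ballI impI)
    show "openin X (V \<inter> {x \<in> topspace X. x \<sqsubset> p})"
      using V(1) openin_lower[OF p(1)] by (rule openin_Int)
    show "order_convex (V \<inter> {x \<in> topspace X. x \<sqsubset> p})"
      using V(5) order_convex_lower by (rule order_convex_Int)
    show "V \<inter> {x \<in> topspace X. x \<sqsubset> p} \<inter> B = {}" using VB by auto
  qed (use a V(2) p ok in simp_all)
  show ?thesis
  proof (cases "\<exists>a'\<in>A \<inter> V. a \<sqsubset> a'")
    case True
    then obtain a' where a': "a' \<in> A" "a' \<in> V" "a \<sqsubset> a'" by (elim bexE IntE)
    have "between a a' \<inter> B = {}"
      using between_subset_convex[OF V(5,2) a'(2)] VB by auto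
    then show ?thesis
      using a' V(4) by (intro cut[of a'] disjI2 bexI[of _ a'] conjI less_imp_le) auto
  next
    case no_a': False
    show ?thesis
    proof (cases "\<exists>z\<in>V. a \<sqsubset> z")
      case False
      then show ?thesis using V VB by (intro exI[of _ V]) simp
    next
      case True
      then obtain w where w: "w \<in> V" "a \<sqsubset> w" by (elim bexE)
      \<comment> \<open>Beyond \<open>a\<close> the set \<open>V\<close> now meets neither
        \<open>A\<close> nor \<open>B\<close>, so this part of it lies in a single component, on
        which \<open>pt\<close> has the value \<open>pt w\<close>.\<close>
      have free: "y \<notin> A \<union> B" if "y \<in> V" "a \<sqsubset> y" for y
        using that no_a' VB by auto
      have wX: "w \<in> topspace X" using V(4) w(1) by (rule subsetD)
      show ?thesis
      proof (rule cut)
        show "pt w \<in> topspace X" using wX by (rule pt_X)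
        show "a \<sqsubset> pt w"
        proof (rule ccontr)
          assume "\<not> a \<sqsubset> pt w"
          then have "a \<in> between w (pt w)" using w(2) a(1) by (simp add: between_def not_less less_imp_le)
          moreover have "between w (pt w) \<inter> (A \<union> B) = {}"
            using free[OF w] wX by (intro pt_between) simp
          ultimately show False using a(2) by auto
        qed
        fix z assume z: "z \<in> V" "z \<sqsubset> pt w" "a \<sqsubset> z"
        have zX: "z \<in> topspace X" using V(4) z(1) by (rule subsetD)
        have "y \<notin> A \<union> B" if y: "y \<in> between z w" for y
        proof (rule free)
          show "y \<in> V" using between_subset_convex[OF V(5) z(1) w(1)] y by (rule subsetD)
          have "z \<sqsubseteq> y \<or> w \<sqsubseteq> y" using y by (auto simp: between_def)
          then show "a \<sqsubset> y" using z(3) w(2) less_le_trans by metis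
        qed
        then have "between z w \<inter> (A \<union> B) = {}" by auto
        then have "pt z = pt w" by (rule pt_eq[OF zX wX])
        then show "z \<sqsubset> pt z \<or> (\<exists>a'\<in>A. z \<sqsubseteq> a' \<and> between a a' \<inter> B = {})" using z(2) by simp
      qed
    qed
  qed
qed

lemma left_separating_nbhd:
  assumes "closedin X B" "a \<in> topspace X" "a \<in> A" "a \<notin> B"
    and "\<And>z. z \<in> topspace X \<Longrightarrow> pt z \<in> topspace X"
    and "\<And>z. z \<in> topspace X - (A \<union> B) \<Longrightarrow> between z (pt z) \<inter> (A \<union> B) = {}"
    and "\<And>z w. z \<in> topspace X \<Longrightarrow> w \<in> topspace X \<Longrightarrow> between z w \<inter> (A \<union> B) = {} \<Longrightarrow> pt z = pt w"
  shows "\<exists>V. openin X V \<and> a \<in> V \<and> order_convex V \<and> V \<inter> B = {} \<and>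
    (\<forall>z\<in>V. z \<sqsubset> a \<longrightarrow> pt z \<sqsubset> z \<or> (\<exists>a'\<in>A. a' \<sqsubseteq> z \<and> between a a' \<inter> B = {}))"
  using assms
  by (rule ordered_go.right_separating_nbhd[OF dual, unfolded order_convex_dual between_dual])

text \<open>The sets are parameters so that the notion can be used with \<open>A\<close> and
  \<open>B\<close> exchanged while \<open>pt\<close> stays the same; sharing \<open>pt\<close> is
  what makes the two kinds of neighbourhood comparable.\<close>

definition separating_nbhd :: "('a \<Rightarrow> 'a) \<Rightarrow> 'a set \<Rightarrow> 'a set \<Rightarrow> 'a \<Rightarrow> 'a set \<Rightarrow> bool" where
  "separating_nbhd pt A B a V \<longleftrightarrow> openin X V \<and> a \<in> V \<and> order_convex V \<and> V \<inter> B = {} \<and>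
    (\<forall>z\<in>V. a \<sqsubset> z \<longrightarrow> z \<sqsubset> pt z \<or> (\<exists>a'\<in>A. z \<sqsubseteq> a' \<and> between a a' \<inter> B = {})) \<and>
    (\<forall>z\<in>V. z \<sqsubset> a \<longrightarrow> pt z \<sqsubset> z \<or> (\<exists>a'\<in>A. a' \<sqsubseteq> z \<and> between a a' \<inter> B = {}))"

lemma separating_nbhd_exists:
  assumes "closedin X B" "a \<in> topspace X" "a \<in> A" "a \<notin> B"
    and "\<And>z. z \<in> topspace X \<Longrightarrow> pt z \<in> topspace X"
    and "\<And>z. z \<in> topspace X - (A \<union> B) \<Longrightarrow> between z (pt z) \<inter> (A \<union> B) = {}"
    and "\<And>z w. z \<in> topspace X \<Longrightarrow> w \<in> topspace X \<Longrightarrow> between z w \<inter> (A \<union> B) = {} \<Longrightarrow> pt z = pt w"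
  shows "\<exists>V. separating_nbhd pt A B a V"
proof -
  have "\<exists>V. openin X V \<and> a \<in> V \<and> order_convex V \<and> V \<inter> B = {} \<and>
    (\<forall>z\<in>V. a \<sqsubset> z \<longrightarrow> z \<sqsubset> pt z \<or> (\<exists>a'\<in>A. z \<sqsubseteq> a' \<and> between a a' \<inter> B = {}))"
    using assms by (rule right_separating_nbhd)
  then obtain V where V: "openin X V" "a \<in> V" "order_convex V" "V \<inter> B = {}"
    "\<forall>z\<in>V. a \<sqsubset> z \<longrightarrow> z \<sqsubset> pt z \<or> (\<exists>a'\<in>A. z \<sqsubseteq> a' \<and> between a a' \<inter> B = {})"
    by (elim exE conjE)
  have "\<exists>V. openin X V \<and> a \<in> V \<and> order_convex V \<and> V \<inter> B = {} \<and>
    (\<forall>z\<in>V. z \<sqsubset> a \<longrightarrow> pt z \<sqsubset> z \<or> (\<exists>a'\<in>A. a' \<sqsubseteq> z \<and> between a a' \<inter> B = {}))"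
    using assms by (rule left_separating_nbhd)
  then obtain W where W: "openin X W" "a \<in> W" "order_convex W" "W \<inter> B = {}"
    "\<forall>z\<in>W. z \<sqsubset> a \<longrightarrow> pt z \<sqsubset> z \<or> (\<exists>a'\<in>A. a' \<sqsubseteq> z \<and> between a a' \<inter> B = {})"
    by (elim exE conjE)
  have "V \<inter> W \<inter> B = {}" using V(4) by auto
  then show ?thesis
    unfolding separating_nbhd_def
    using V(2,5) W(2,5) openin_Int[OF V(1) W(1)] order_convex_Int[OF V(3) W(3)]
    by (intro exI[of _ "V \<inter> W"]) simp
qed

text \<open>A common point \<open>z\<close> lies strictly between \<open>a\<close> and
  \<open>b\<close>. The alternative with \<open>a'\<close> would place a point of \<open>A\<close>
  between \<open>z\<close> and \<open>b\<close>, hence in the convex set \<open>W\<close>, which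
  misses \<open>A\<close>; so \<open>z\<close> lies below \<open>pt z\<close>. Symmetrically
  \<open>z\<close> lies above \<open>pt z\<close>.\<close>

lemma separating_nbhds_disjoint:
  assumes V: "separating_nbhd pt A B a V" and W: "separating_nbhd pt B A b W"
    and a: "a \<in> A" "a \<in> topspace X" and b: "b \<in> B" "b \<in> topspace X"
    and AB: "A \<subseteq> topspace X" "B \<subseteq> topspace X"
    and less: "a \<sqsubset> b"
  shows "V \<inter> W = {}"
proof (rule ccontr)
  have V': "openin X V" "a \<in> V" "order_convex V" "V \<inter> B = {}"
    "\<forall>z\<in>V. a \<sqsubset> z \<longrightarrow> z \<sqsubset> pt z \<or> (\<exists>a'\<in>A. z \<sqsubseteq> a' \<and> between a a' \<inter> B = {})"
    using V unfolding separating_nbhd_def by - (elim conjE, assumption)+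
  have W': "openin X W" "b \<in> W" "order_convex W" "W \<inter> A = {}"
    "\<forall>z\<in>W. z \<sqsubset> b \<longrightarrow> pt z \<sqsubset> z \<or> (\<exists>b'\<in>B. b' \<sqsubseteq> z \<and> between b b' \<inter> A = {})"
    using W unfolding separating_nbhd_def by - (elim conjE, assumption)+
  have AW: "x \<notin> W" if "x \<in> A" for x using W'(4) that by auto
  have BV: "x \<notin> V" if "x \<in> B" for x using V'(4) that by auto
  assume "V \<inter> W \<noteq> {}"
  then obtain z where z: "z \<in> V" "z \<in> W" by auto
  have az: "a \<sqsubset> z"
  proof (rule ccontr)
    assume "\<not> a \<sqsubset> z"
    then have "a \<in> W" using order_convexD[OF W'(3) z(2) W'(2) a(2)] less by (simp add: not_less)
    then show False using AW[OF a(1)] by simp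
  qed
  have zb: "z \<sqsubset> b"
  proof (rule ccontr)
    assume "\<not> z \<sqsubset> b"
    then have "b \<in> V" using order_convexD[OF V'(3) V'(2) z(1) b(2)] less by (simp add: not_less)
    then show False using BV[OF b(1)] by simp
  qed
  have "z \<sqsubset> pt z"
  proof (rule ccontr)
    assume "\<not> z \<sqsubset> pt z"
    then obtain a' where a': "a' \<in> A" "z \<sqsubseteq> a'" "between a a' \<inter> B = {}"
      using V'(5)[rule_format, OF z(1) az] by (elim disjE bexE conjE) simp_all
    have "a' \<sqsubset> b"
    proof (rule ccontr)
      assume "\<not> a' \<sqsubset> b"
      then have "b \<in> between a a'" using less b(2) by (simp add: between_def not_less less_imp_le)
      then show False using a'(3) b(1) by auto
    qed
    then have "a' \<in> W"
      using order_convexD[OF W'(3) z(2) W'(2) subsetD[OF AB(1) a'(1)] a'(2)] by simp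
    then show False using AW[OF a'(1)] by simp
  qed
  moreover have "pt z \<sqsubset> z"
  proof (rule ccontr)
    assume "\<not> pt z \<sqsubset> z"
    then obtain b' where b': "b' \<in> B" "b' \<sqsubseteq> z" "between b b' \<inter> A = {}"
      using W'(5)[rule_format, OF z(2) zb] by (elim disjE bexE conjE) simp_all
    have "a \<sqsubset> b'"
    proof (rule ccontr)
      assume "\<not> a \<sqsubset> b'"
      then have "a \<in> between b b'" using less a(2) by (simp add: between_def not_less less_imp_le)
      then show False using b'(3) a(1) by auto
    qed
    then have "b' \<in> V"
      using order_convexD[OF V'(3) V'(2) z(1) subsetD[OF AB(2) b'(1)] _ b'(2)] by simp
    then show False using BV[OF b'(1)] by simp
  qed
  ultimately show False by order
qed

lemma normal: "normal_space X"
  unfolding normal_space_def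
proof (intro allI impI, elim conjE)
  fix A B assume A: "closedin X A" and B: "closedin X B" and "disjnt A B"
  then have disj: "A \<inter> B = {}" by (simp add: disjnt_def)
  have AX: "A \<subseteq> topspace X" and BX: "B \<subseteq> topspace X" using A B by (simp_all add: closedin_subset)
  \<comment> \<open>\<open>P z\<close> describes the component of \<open>z\<close>. It is the same
    predicate for all points of a component, so \<open>Eps\<close> selects the same point for all of
    them. For points of \<open>A\<close> or \<open>B\<close> it is empty, and the default
    \<open>z\<close> keeps \<open>pt z\<close> in the space.\<close>
  define P where "P z w \<longleftrightarrow> w \<in> topspace X \<and> between z w \<inter> (A \<union> B) = {}" for z w
  define pt where "pt z = (if Ex (P z) then Eps (P z) else z)" for z
  have P_pt: "P z (pt z)" if "Ex (P z)" for z
    unfolding pt_def using that someI_ex[OF that] by simp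
  have pt_X: "pt z \<in> topspace X" if "z \<in> topspace X" for z
  proof (cases "Ex (P z)")
    case True
    then show ?thesis using P_pt[OF True] unfolding P_def by simp
  next
    case False
    then have "pt z = z" unfolding pt_def by (rule if_not_P)
    then show ?thesis using that by simp
  qed
  have pt_between: "between z (pt z) \<inter> (A \<union> B) = {}" if "z \<in> topspace X - (A \<union> B)" for z
  proof -
    have "between z z \<subseteq> {z}" by (auto simp: between_def)
    then have "P z z" unfolding P_def using that by auto
    then have "Ex (P z)" by (rule exI)
    then have "P z (pt z)" by (rule P_pt)
    then show ?thesis unfolding P_def by simp
  qed
  have pt_eq: "pt z = pt w"
    if "z \<in> topspace X" "w \<in> topspace X" "between z w \<inter> (A \<union> B) = {}" for z w
  proof -
    have "P z = P w"
    proof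
      fix v
      show "P z v = P w v"
        unfolding P_def using between_subset[of z v w] between_subset[of w v z] that(3)
          between_commute[of z w] by auto
    qed
    moreover have "Ex (P z)" using that unfolding P_def by (intro exI[of _ w]) simp
    ultimately show ?thesis unfolding pt_def by simp
  qed
  have "\<exists>V. separating_nbhd pt A B a V" if "a \<in> A" for a
    using that disj AX by (intro separating_nbhd_exists[OF B _ _ _ pt_X pt_between pt_eq]) auto
  then obtain V where V: "\<And>a. a \<in> A \<Longrightarrow> separating_nbhd pt A B a (V a)" by metis
  have "\<exists>V. separating_nbhd pt B A b V" if "b \<in> B" for b
    using that disj BX
    by (intro separating_nbhd_exists[OF A _ _ _ pt_X pt_between[unfolded Un_commute[of A B]] pt_eq[unfolded Un_commute[of A B]]]) auto
  then obtain W where W: "\<And>b. b \<in> B \<Longrightarrow> separating_nbhd pt B A b (W b)" by metis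
  have VW: "V a \<inter> W b = {}" if ab: "a \<in> A" "b \<in> B" for a b
  proof -
    have abX: "a \<in> topspace X" "b \<in> topspace X" using ab AX BX by auto
    have "a \<noteq> b" using ab disj by auto
    then consider "a \<sqsubset> b" | "b \<sqsubset> a" using neqE by metis
    then show ?thesis
    proof cases
      case 1
      show ?thesis by (rule separating_nbhds_disjoint[OF V[OF ab(1)] W[OF ab(2)] ab(1) abX(1) ab(2) abX(2) AX BX 1])
    next
      case 2
      have "W b \<inter> V a = {}" by (rule separating_nbhds_disjoint[OF W[OF ab(2)] V[OF ab(1)] ab(2) abX(2) ab(1) abX(1) BX AX 2])
      then show ?thesis by (simp add: Int_commute)
    qed
  qed
  show "\<exists>U V. openin X U \<and> openin X V \<and> A \<subseteq> U \<and> B \<subseteq> V \<and> disjnt U V"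
  proof (intro exI conjI)
    show "openin X (\<Union>a\<in>A. V a)" "openin X (\<Union>b\<in>B. W b)"
      using V W unfolding separating_nbhd_def by auto
    show "A \<subseteq> (\<Union>a\<in>A. V a)" "B \<subseteq> (\<Union>b\<in>B. W b)"
      using V W unfolding separating_nbhd_def by auto
    show "disjnt (\<Union>a\<in>A. V a) (\<Union>b\<in>B. W b)" using VW unfolding disjnt_def by auto
  qed
qed

end

section \<open>The order of a GO space\<close>

text \<open>The subbasic sets, \<open>A\<close> and the open rays, are convex. Convexity passes to
  intersections, and having a convex open neighbourhood inside the set around each point passes to
  unions, so induction on the generation of \<open>W\<close> applies.\<close>

lemma order_topology_on_convex_base:
  assumes r: "linear_order_on A r" and "openin (order_topology_on A r) W" "x \<in> W"
  shows "\<exists>V. openin (order_topology_on A r) V \<and> x \<in> V \<and> V \<subseteq> W \<and>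
    (\<forall>a\<in>V. \<forall>b\<in>V. \<forall>z\<in>A. (a, z) \<in> r \<longrightarrow> (z, b) \<in> r \<longrightarrow> z \<in> V)"
proof -
  let ?S = "insert A
         ((\<lambda>a. {x \<in> A. (x, a) \<in> r \<and> x \<noteq> a}) ` A \<union>
          (\<lambda>a. {x \<in> A. (a, x) \<in> r \<and> x \<noteq> a}) ` A)"
  let ?T = "topology_generated_by ?S"
  let ?conv = "\<lambda>V. \<forall>a\<in>V. \<forall>b\<in>V. \<forall>z\<in>A. (a, z) \<in> r \<longrightarrow> (z, b) \<in> r \<longrightarrow> z \<in> V"
  have tr: "(p, s) \<in> r" if "(p, q) \<in> r" "(q, s) \<in> r" for p q s
    using r that unfolding linear_order_on_def partial_order_on_def preorder_on_def by (meson transD)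
  have an: "p = q" if "(p, q) \<in> r" "(q, p) \<in> r" for p q
    using r that unfolding linear_order_on_def partial_order_on_def by (meson antisymD)
  have "generate_topology_on ?S W"
    using assms(2) unfolding order_topology_on_def openin_topology_generated_by_iff .
  then have "\<forall>x\<in>W. \<exists>V. openin ?T V \<and> x \<in> V \<and> V \<subseteq> W \<and> ?conv V"
  proof induction
    case Empty
    then show ?case by simp
  next
    case (Int U W)
    show ?case
    proof
      fix x assume x: "x \<in> U \<inter> W"
      then have xU: "x \<in> U" and xW: "x \<in> W" by simp_all
      obtain V1 where V1: "openin ?T V1" "x \<in> V1" "V1 \<subseteq> U" "?conv V1"
        using bspec[OF Int.IH(1) xU] by (elim exE conjE)
      obtain V2 where V2: "openin ?T V2" "x \<in> V2" "V2 \<subseteq> W" "?conv V2"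
        using bspec[OF Int.IH(2) xW] by (elim exE conjE)
      have "V1 \<inter> V2 \<subseteq> U \<inter> W" using V1(3) V2(3) by (rule Int_mono)
      moreover have "?conv (V1 \<inter> V2)"
      proof (intro ballI impI IntI)
        fix a b z assume h: "a \<in> V1 \<inter> V2" "b \<in> V1 \<inter> V2" "z \<in> A" "(a, z) \<in> r" "(z, b) \<in> r"
        show "z \<in> V1" using V1(4)[rule_format, OF IntD1[OF h(1)] IntD1[OF h(2)] h(3-5)] .
        show "z \<in> V2" using V2(4)[rule_format, OF IntD2[OF h(1)] IntD2[OF h(2)] h(3-5)] .
      qed
      ultimately show "\<exists>V. openin ?T V \<and> x \<in> V \<and> V \<subseteq> U \<inter> W \<and> ?conv V"
        using openin_Int[OF V1(1) V2(1)] IntI[OF V1(2) V2(2)] by (intro exI[of _ "V1 \<inter> V2"] conjI)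
    qed
  next
    case (UN K)
    show ?case
    proof
      fix x assume "x \<in> \<Union>K"
      then obtain k where k: "k \<in> K" "x \<in> k" by (elim UnionE)
      then obtain V where V: "openin ?T V" "x \<in> V" "V \<subseteq> k" "?conv V"
        using bspec[OF UN.IH[OF k(1)] k(2)] by (elim exE conjE)
      have "V \<subseteq> \<Union>K" using V(3) k(1) by auto
      then show "\<exists>V. openin ?T V \<and> x \<in> V \<and> V \<subseteq> \<Union>K \<and> ?conv V"
        using V by (intro exI[of _ V] conjI)
    qed
  next
    case (Basis s)
    have "openin ?T s" using Basis by (rule topology_generated_by_Basis)
    moreover have "?conv s"
    proof (intro ballI impI)
      fix a b z assume h: "a \<in> s" "b \<in> s" "z \<in> A" "(a, z) \<in> r" "(z, b) \<in> r"
      consider "s = A" | c where "s = {x \<in> A. (x, c) \<in> r \<and> x \<noteq> c}" | c where "s = {x \<in> A. (c, x) \<in> r \<and> x \<noteq> c}"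
        using Basis by (elim insertE UnE imageE)
      then show "z \<in> s"
      proof cases
        case 1
        then show ?thesis using h(3) by simp
      next
        case (2 c)
        have b: "(b, c) \<in> r" "b \<noteq> c" using h(2) 2 by simp_all
        have "z \<noteq> c" using an[OF h(5)] b by auto
        then show ?thesis using 2 h(3) tr[OF h(5) b(1)] by simp
      next
        case (3 c)
        have a: "(c, a) \<in> r" "a \<noteq> c" using h(1) 3 by simp_all
        have "z \<noteq> c" using an[OF h(4)] a by auto
        then show ?thesis using 3 h(3) tr[OF a(1) h(4)] by simp
      qed
    qed
    ultimately have "openin ?T s \<and> x \<in> s \<and> s \<subseteq> s \<and> ?conv s" if "x \<in> s" for x
      using that by (intro conjI subset_refl)
    then show ?case by (intro ballI exI)
  qed
  then show ?thesis using assms(3) unfolding order_topology_on_def by (rule bspec)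
qed

text \<open>
  The order is extended to the whole type, with the points outside \<open>S\<close> placed on top, so that
  the class locale \<^locale>\<open>linorder\<close> applies.
\<close>

lemma linorder_extending_pullback:
  fixes f :: "'a \<Rightarrow> 'b"
  assumes r: "linear_order_on A r" and f: "inj_on f S" "f ` S \<subseteq> A"
  obtains le lt where "class.linorder le lt"
    "\<And>x y. x \<in> S \<Longrightarrow> y \<in> S \<Longrightarrow> le x y \<longleftrightarrow> (f x, f y) \<in> r"
proof -
  \<comment> \<open>An arbitrary linear order of the type, supplied by the well-ordering theorem,
    arranges the points outside \<open>S\<close>.\<close>
  obtain w :: "'a rel" where w: "linear_order_on UNIV w"
    using well_ordering unfolding well_order_on_def by metis
  have rrefl: "(p, p) \<in> r" if "p \<in> A" for p
    using r that unfolding linear_order_on_def partial_order_on_def preorder_on_def by (meson refl_onD)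
  have rtr: "(p, s) \<in> r" if "(p, q) \<in> r" "(q, s) \<in> r" for p q s
    using r that unfolding linear_order_on_def partial_order_on_def preorder_on_def by (meson transD)
  have ran: "p = q" if "(p, q) \<in> r" "(q, p) \<in> r" for p q
    using r that unfolding linear_order_on_def partial_order_on_def by (meson antisymD)
  have rtot: "(p, q) \<in> r \<or> (q, p) \<in> r" if "p \<in> A" "q \<in> A" for p q
    using r that rrefl unfolding linear_order_on_def total_on_def by metis
  have wrefl: "(p, p) \<in> w" for p
    using w unfolding linear_order_on_def partial_order_on_def preorder_on_def by (simp add: refl_on_def)
  have wtr: "(p, s) \<in> w" if "(p, q) \<in> w" "(q, s) \<in> w" for p q s
    using w that unfolding linear_order_on_def partial_order_on_def preorder_on_def by (meson transD)
  have wan: "p = q" if "(p, q) \<in> w" "(q, p) \<in> w" for p q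
    using w that unfolding linear_order_on_def partial_order_on_def by (meson antisymD)
  have wtot: "(p, q) \<in> w \<or> (q, p) \<in> w" for p q
    using w wrefl unfolding linear_order_on_def total_on_def by (metis UNIV_I)
  have fA: "f x \<in> A" if "x \<in> S" for x using f(2) that by auto
  define le where "le x y \<longleftrightarrow> (if x \<in> S then y \<in> S \<longrightarrow> (f x, f y) \<in> r else y \<notin> S \<and> (x, y) \<in> w)" for x y
  have "class.linorder le (\<lambda>x y. le x y \<and> \<not> le y x)"
  proof unfold_locales
    show "le x x" for x unfolding le_def using rrefl fA wrefl by simp
    show "le x z" if "le x y" "le y z" for x y z
      using that rtr[of "f x" "f y" "f z"] wtr[of x y z] unfolding le_def by (simp split: if_splits)
    show "x = y" if "le x y" "le y x" for x y
      using that ran[of "f x" "f y"] wan[of x y] inj_onD[OF f(1), of x y] unfolding le_def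
      by (simp split: if_splits)
    show "le x y \<or> le y x" for x y
      using rtot[of "f x" "f y"] wtot[of x y] fA unfolding le_def by simp
  qed simp
  then show ?thesis by (rule that) (simp add: le_def)
qed

text \<open>The order is pulled back along the embedding. Preimages of open rays at image points are
  open rays, and preimages of convex sets are convex. The topology of \<open>X\<close> may be finer
  than the order topology of the pulled-back order, which is why the locale asks only for open rays
  and a convex base.\<close>

lemma GO_space_imp_ordered_go:
  fixes X :: "'a topology"
  assumes "GO_space TYPE('b) X"
  shows "\<exists>le lt. ordered_go le lt X"
proof -
  obtain L :: "'b topology" and f where L: "LOTS L" and f: "embedding_map X L f"
    using assms unfolding GO_space_def by (elim exE conjE)
  define A where "A = topspace L"
  obtain r where r: "linear_order_on A r" and LA: "L = order_topology_on A r"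
    using L unfolding LOTS_def A_def by (elim exE conjE)
  let ?S = "topspace X"
  have hom: "homeomorphic_map X (subtopology L (f ` ?S)) f" using f unfolding embedding_map_def .
  have cont: "continuous_map X L f"
    using homeomorphic_imp_continuous_map[OF hom] continuous_map_in_subtopology by metis
  have inj: "inj_on f ?S" using hom by (rule homeomorphic_imp_injective_map)
  have fA: "f ` ?S \<subseteq> A" using continuous_map_image_subset_topspace[OF cont] A_def by simp
  obtain le lt where lin: "class.linorder le lt"
    and le: "\<And>x y. x \<in> ?S \<Longrightarrow> y \<in> ?S \<Longrightarrow> le x y \<longleftrightarrow> (f x, f y) \<in> r"
    using linorder_extending_pullback[OF r inj fA] by metis
  interpret linorder le lt by (rule lin)
  have lt: "lt x y \<longleftrightarrow> (f x, f y) \<in> r \<and> f x \<noteq> f y" if "x \<in> ?S" "y \<in> ?S" for x y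
    using le[OF that] inj_onD[OF inj _ that] less_le[of x y] by metis
  have pre: "openin X {x \<in> ?S. f x \<in> U}" if "openin L U" for U
    using cont that by (rule openin_continuous_map_preimage)
  have "ordered_go le lt X"
    unfolding ordered_go_def ordered_go_axioms_def
  proof (intro conjI allI impI)
    fix a assume a: "a \<in> ?S"
    then have fa: "f a \<in> A" using fA by auto
    have low: "openin L {y \<in> A. (y, f a) \<in> r \<and> y \<noteq> f a}"
      unfolding LA order_topology_on_def using fa by (intro topology_generated_by_Basis) simp
    have "{x \<in> ?S. f x \<in> {y \<in> A. (y, f a) \<in> r \<and> y \<noteq> f a}} = {x \<in> ?S. lt x a}"
      using fA lt[OF _ a] by auto
    then show "openin X {x \<in> ?S. lt x a}" using pre[OF low] by simp
    have up: "openin L {y \<in> A. (f a, y) \<in> r \<and> y \<noteq> f a}"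
      unfolding LA order_topology_on_def using fa by (intro topology_generated_by_Basis) simp
    have "{x \<in> ?S. f x \<in> {y \<in> A. (f a, y) \<in> r \<and> y \<noteq> f a}} = {x \<in> ?S. lt a x}"
      using fA lt[OF a] by auto
    then show "openin X {x \<in> ?S. lt a x}" using pre[OF up] by simp
  next
    fix U x assume U: "openin X U" and x: "x \<in> U"
    have US: "U \<subseteq> ?S" using U by (rule openin_subset)
    have "openin (subtopology L (f ` ?S)) (f ` U)"
      using homeomorphic_imp_open_map[OF hom] U unfolding open_map_def by simp
    then obtain W where W: "openin L W" "f ` U = W \<inter> f ` ?S" unfolding openin_subtopology by auto
    have "f x \<in> W" using W(2) x by auto
    with W(1) obtain V where V: "openin L V" "f x \<in> V" "V \<subseteq> W"
        "\<forall>a\<in>V. \<forall>b\<in>V. \<forall>z\<in>A. (a, z) \<in> r \<longrightarrow> (z, b) \<in> r \<longrightarrow> z \<in> V"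
      using order_topology_on_convex_base[OF r, of W "f x"] unfolding LA by (elim meta_impE exE conjE)
    have "{y \<in> ?S. f y \<in> V} \<subseteq> U"
    proof
      fix y assume y: "y \<in> {y \<in> ?S. f y \<in> V}"
      then have "f y \<in> f ` U" using W(2) V(3) by auto
      then obtain u where "u \<in> U" "f y = f u" by auto
      moreover have "y = u" using inj_onD[OF inj \<open>f y = f u\<close>] y \<open>u \<in> U\<close> US by auto
      ultimately show "y \<in> U" by simp
    qed
    moreover have "\<forall>a\<in>{y \<in> ?S. f y \<in> V}. \<forall>b\<in>{y \<in> ?S. f y \<in> V}. \<forall>z\<in>?S. le a z \<longrightarrow> le z b \<longrightarrow> z \<in> {y \<in> ?S. f y \<in> V}"
    proof (intro ballI impI)
      fix a b z assume h: "a \<in> {y \<in> ?S. f y \<in> V}" "b \<in> {y \<in> ?S. f y \<in> V}" "z \<in> ?S" "le a z" "le z b"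
      then have "f z \<in> A" using fA by auto
      moreover have "(f a, f z) \<in> r" "(f z, f b) \<in> r" using h le by simp_all
      ultimately show "z \<in> {y \<in> ?S. f y \<in> V}" using V(4)[rule_format, of "f a" "f b" "f z"] h by simp
    qed
    moreover have "x \<in> {y \<in> ?S. f y \<in> V}" using x US V(2) by auto
    ultimately show "\<exists>V. openin X V \<and> x \<in> V \<and> V \<subseteq> U \<and>
        (\<forall>a\<in>V. \<forall>b\<in>V. \<forall>z\<in>?S. le a z \<longrightarrow> le z b \<longrightarrow> z \<in> V)"
      using pre[OF V(1)] by (intro exI[of _ "{y \<in> ?S. f y \<in> V}"] conjI)
  qed (rule lin)
  then show ?thesis by (intro exI)
qed

section \<open>The equivalence, as a cycle of three implications\<close>

theorem corollary6:
  fixes X :: "'a topology"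
  assumes "GO_space TYPE('b) X"
    and "scattered_space X \<or> locally_countable_space X"
  shows "(functionally_countable X \<longleftrightarrow> exponentially_separable X) \<and>
         (exponentially_separable X \<longleftrightarrow> countable_extent X)"
proof -
  obtain le lt where "ordered_go le lt X" using GO_space_imp_ordered_go[OF assms(1)] by (elim exE)
  then interpret ordered_go le lt X .
  have "functionally_countable X" if "exponentially_separable X"
    using that by (rule exponentially_separable_imp_functionally_countable)
  moreover have "countable_extent X" if "functionally_countable X"
    using normal that by (rule normal_functionally_countable_imp_countable_extent)
  moreover have "exponentially_separable X" if "countable_extent X"
    using that assms(2) by (rule countable_extent_imp_exponentially_separable)
  ultimately show ?thesis by (intro conjI iffI) simp_all
qed

end
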